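(* Let $\mathring P$ and $N$ be $m\times m$ matrix-valued functions, which may vary with $n$, defined in a neighborhood of $\overline{D(0,r)}$ for some $r>0$. Let $a,b,c,d,e\ge 0$ satisfy $$a\le e<b\qquad\text{and}\qquad d<\min(b,c),$$ and assume $r>1$ in case $a=0$. Suppose that, uniformly for $z\in\partial D(0,n^{-a})$ as $n\to\infty$, $$\mathring P(z)N(z)^{-1}E(z)=\mathbb I+\frac{C(z)}{n^b z}+\mathcal O(n^{-c}),$$ where $C$ and $E$ are $m\times m$ matrix-valued functions in a neighborhood of $\overline{D(0,r)}$ that may vary with $n$, and (i) $C$ is meromorphic with only a possible pole at $z=0$, whose order is bounded by some non-negative integer $p$ for all $n$, and $C$ is uniformly bounded for $z\in\partial D(0,n^{-a})$ as $n\to\infty$; (ii) $E$ is non-singular and analytic, and uniformly for $z,w\in\partial D(0,n^{-a})$ we have, as $n\to\infty$, $$E(z)=\mathcal O(n^{d/2}),\qquad E(z)^{-1}=\mathcal O(n^{d/2}),\qquad E(z)^{-1}E(w)=\mathbb I+\mathcal O(n^e(z-w)).$$ Then there are non-singular analytic functions $E_n^0:\overline{D(0,n^{-a})}\to\mathbb C^{m\times m}$ and $E_n^\infty:\overline{A(0;n^{-a},\infty)}\to\mathbb C^{m\times m}$ such that, as $n\to\infty$, $$E_n^0(z)\mathring P(z)=\left(\mathbb I+\mathcal O(n^{d-c})\right)E_n^\infty(z)N(z)\quad\text{uniformly for }z\in\partial D(0,n^{-a}),$$ $$E_n^\infty(z)=\mathbb I+\mathcal O(n^{d-b})\quad\text{uniformly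 for }z\in\partial D(0,r).$$
   Context: $m$ is a fixed positive integer, $\mathbb I$ is the $m\times m$ identity matrix, and $n=1,2,\ldots$ is a parameter. $D(0,\rho)=\{z\in\mathbb C:|z|<\rho\}$, $A(0;r_1,r_2)=\{z\in\mathbb C:r_1<|z|<r_2\}$; overlines denote closures. For matrix-valued quantities, $X=\mathcal O(g)$ as $n\to\infty$ means $\|X\|\le M|g|$ for all sufficiently large $n$, with $M$ independent of $n$; "uniformly" means that $M$ and the threshold on $n$ do not depend on the indicated variables. An $\mathcal O$-term inside a product stands for some matrix-valued function satisfying that bound. "Non-singular" means invertible at every point of the domain. Analytic on a closed set means analytic in a neighborhood of it. No smoothness is imposed on $\mathring P$ and $N$; $N(z)$ is understood to be invertible where $N(z)^{-1}$ appears. *)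

theory Defs
  imports "HOL-Complex_Analysis.Complex_Analysis"
begin

text \<open>
  The norm on matrices is the library norm of \<^typ>\<open>complex^'m^'m\<close>, i.e. the Frobenius norm.
  All norms on this finite-dimensional space are equivalent, so the bounds below do not depend
  on this choice.
\<close>

text \<open>
  \<open>X\<^sub>n(x) = O(g\<^sub>n(x))\<close> as \<open>n \<rightarrow> \<infinity>\<close>, uniformly for \<open>x\<close> in the \<open>n\<close>-dependent set \<open>S\<^sub>n\<close>: both the
  constant and the threshold on \<open>n\<close> are independent of \<open>x\<close>.
\<close>

definition uniform_bigo ::
  "(nat \<Rightarrow> 'a set) \<Rightarrow> (nat \<Rightarrow> 'a \<Rightarrow> 'b::real_normed_vector) \<Rightarrow>
    (nat \<Rightarrow> 'a \<Rightarrow> 'c::real_normed_vector) \<Rightarrow> bool" where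
  "uniform_bigo S X g \<longleftrightarrow>
     (\<exists>M. \<forall>\<^sub>F n in sequentially. \<forall>x\<in>S n. norm (X n x) \<le> M * norm (g n x))"

definition shrinking_circle :: "real \<Rightarrow> nat \<Rightarrow> complex set" where
  "shrinking_circle a n = sphere 0 (real n powr (- a))"

text \<open>
  As for \<^const>\<open>analytic_on\<close>, the functions are total and analyticity on a closed set means
  analyticity in a neighbourhood of it.
\<close>

definition matrix_analytic_on :: "(complex \<Rightarrow> complex^'m^'m) \<Rightarrow> complex set \<Rightarrow> bool" where
  "matrix_analytic_on F S \<longleftrightarrow> (\<forall>i j. (\<lambda>z. F z $ i $ j) analytic_on S)"

definition nonsingular_analytic_on :: "(complex \<Rightarrow> complex^'m^'m) \<Rightarrow> complex set \<Rightarrow> bool" where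
  "nonsingular_analytic_on F S \<longleftrightarrow> matrix_analytic_on F S \<and> (\<forall>z\<in>S. invertible (F z))"

text \<open>
  The pole order of a matrix-valued function is the largest pole order among its entries;
  \<^const>\<open>zorder\<close> is the negative of the order at a pole. The value of \<open>F\<close> at \<open>0\<close> itself is
  irrelevant.
\<close>

definition meromorphic_pole_at_0_only ::
  "(complex \<Rightarrow> complex^'m^'m) \<Rightarrow> complex set \<Rightarrow> nat \<Rightarrow> bool" where
  "meromorphic_pole_at_0_only F S p \<longleftrightarrow>
     matrix_analytic_on F (S - {0}) \<and>
     (\<forall>i j. (\<lambda>z. F z $ i $ j) meromorphic_on S \<and>
            (is_pole (\<lambda>z. F z $ i $ j) 0 \<longrightarrow> - zorder (\<lambda>z. F z $ i $ j) 0 \<le> int p))"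

definition matrix_divide :: "complex^'m^'m \<Rightarrow> complex \<Rightarrow> complex^'m^'m" where
  "matrix_divide A k = (\<chi> i j. A $ i $ j / k)"

end

(*
On the circle |z| = \<rho> = n^(-a) write K = C / (n^b z). The task is to factorize the jump E (1 + K) E^(-1)
as F^(-1) G with F analytic in the disc and G analytic outside it, normalised by G(\<infinity>) = 1. The
matrix K has size n^(a-b), but conjugation by E costs a factor n^d, which can make the jump large, so
small-norm theory does not apply directly. Rewriting the problem as F = E - [F K E^(-1)]_+ E and
splitting E(w)^(-1) E(z) = 1 + O(n^e (w - z)) inside the Cauchy integral cancels the two conjugating
factors: the first summand contributes n^(a-b), and in the second the factor w - z cancels the Cauchy
kernel, leaving n^(a-b) n^e \<rho> = n^(e-b). The Neumann series therefore converges. To avoid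
singular integrals at the boundary, [.]_+ is computed with circles of radii \<rho>/2 and 3\<rho>/4; the
bound on the order of the pole of C controls K there. The transposed problem for
E (1 + K)^(-1) E^(-1) gives the inverse factors by Liouville's theorem, with the same bounds O(n^(d/2))
on the circle, so that the error O(n^(-c)) of the matching condition becomes O(n^(d-c)).
*)
theory Submission
  imports Defs
begin

section \<open>Matrices with the Frobenius norm\<close>

text \<open>The unknown carries a factor E on the right: the equation solved is F (1 + K) = G E, so
  \<open>interior_factor\<close> is the interior factor of the conjugated jump times E. This is why
  the iteration starts from E and why each Cauchy integral over f K E^(-1) is followed by E(z): only
  then do E^(-1)(w) and E(z) meet. Invertibility of the factors cannot be read off from norms. On
  the circle the bound obtained for G - 1 is of order n^(a+d-b), which may grow, and F is only known
  to be O(n^(d/2)). Hence the second factorization and Liouville's theorem; that problem is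
  transposed because its factors must multiply from the other side for the middle terms to cancel.
  The bounds on E and on its difference quotient are given on the circle only, while the integrals
  run inside it; maximum modulus arguments carry them inwards. Scalar theorems are applied
  entrywise, which costs powers of m in the constants, and the Frobenius norm of the identity, the
  square root of m, enters them as well.\<close>

lemma norm_vector_smult: "norm (c *s v) = norm c * norm (v :: complex^'n)"
  unfolding norm_vec_def by (simp add: norm_mult L2_set_right_distrib)

lemma norm_matrix_mult_le: "norm (A ** B) \<le> norm A * norm (B :: complex^'n^'k)"
  for A :: "complex^'k^'m"
proof -
  have row: "norm ((A ** B) $ i) \<le> norm (A $ i) * norm B" for i
  proof -
    have "(A ** B) $ i = (\<Sum>k\<in>UNIV. A $ i $ k *s B $ k)"
      by (simp add: vec_eq_iff matrix_matrix_mult_def)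
    also have "norm \<dots> \<le> (\<Sum>k\<in>UNIV. \<bar>norm (A $ i $ k)\<bar> * \<bar>norm (B $ k)\<bar>)"
      by (rule order_trans[OF norm_sum]) (simp add: norm_vector_smult)
    also have "\<dots> \<le> norm (A $ i) * norm B"
      unfolding norm_vec_def by (rule order_trans[OF L2_set_mult_ineq]) (simp add: norm_vec_def)
    finally show ?thesis .
  qed
  have "norm (A ** B) \<le> L2_set (\<lambda>i. norm (A $ i) * norm B) UNIV"
    unfolding norm_vec_def[of "A ** B"] by (rule L2_set_mono) (use row in auto)
  also have "\<dots> = norm A * norm B"
    unfolding norm_vec_def[of A] by (simp add: L2_set_left_distrib)
  finally show ?thesis .
qed

lemma norm_matrix_mult_le_mono:
  fixes A :: "complex^'k^'m" and B :: "complex^'n^'k"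
  assumes "norm A \<le> x" "norm B \<le> y"
  shows "norm (A ** B) \<le> x * y"
  by (rule order_trans[OF norm_matrix_mult_le mult_mono])
     (use assms order_trans[OF norm_ge_zero] in auto)

lemma norm_matrix_entry_le: "norm (A $ i $ j) \<le> norm (A :: complex^'n^'m)"
  by (meson Finite_Cartesian_Product.norm_nth_le order_trans)

text \<open>Crude passage from entries to the Frobenius norm, needed because Cauchy integrals and
  maximum modulus are used entrywise. It is the source of the powers of \<open>CARD('m)\<close> in
  all later constants.\<close>

lemma norm_matrix_le_entries:
  fixes A :: "complex^'m^'m"
  assumes "\<And>i j. norm (A $ i $ j) \<le> B"
  shows "norm A \<le> (real CARD('m))\<^sup>2 * B"
proof -
  have "norm A \<le> (\<Sum>i\<in>UNIV. norm (A $ i))"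
    unfolding norm_vec_def[of A] by (rule L2_set_le_sum) simp
  also have "\<dots> \<le> (\<Sum>i\<in>(UNIV::'m set). \<Sum>j\<in>(UNIV::'m set). B)"
  proof (rule sum_mono)
    fix i
    have "norm (A $ i) \<le> (\<Sum>j\<in>UNIV. norm (A $ i $ j))"
      unfolding norm_vec_def[of "A $ i"] by (rule L2_set_le_sum) simp
    also have "\<dots> \<le> (\<Sum>j\<in>(UNIV::'m set). B)"
      by (rule sum_mono) (rule assms)
    finally show "norm (A $ i) \<le> (\<Sum>j\<in>(UNIV::'m set). B)" .
  qed
  finally show ?thesis by (simp add: power2_eq_square)
qed

text \<open>Lets the transposed factorization problem inherit the bounds of the original one without
  loss.\<close>

lemma norm_transpose [simp]: "norm (transpose A) = norm (A :: complex^'n^'m)"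
proof -
  have *: "(norm A)\<^sup>2 = (\<Sum>i\<in>UNIV. \<Sum>j\<in>UNIV. (norm (A $ i $ j))\<^sup>2)"
    for A :: "complex^'k^'l"
    by (simp add: norm_vec_def L2_set_def sum_nonneg)
  have "(norm (transpose A))\<^sup>2 = (norm A)\<^sup>2"
    unfolding * by (subst sum.swap) (simp add: transpose_def)
  then show ?thesis by (simp add: power2_eq_iff_nonneg)
qed

lemma matrix_add_rdistrib_complex: "(A + B) ** C = A ** C + B ** C"
  for A B :: "complex^'k^'m" and C :: "complex^'n^'k"
  by (simp add: vec_eq_iff matrix_matrix_mult_def algebra_simps sum.distrib)

lemma bounded_bilinear_matrix_mult:
  "bounded_bilinear ((**) :: complex^'k^'m \<Rightarrow> complex^'n^'k \<Rightarrow> complex^'n^'m)"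
proof
  fix A A' :: "complex^'k^'m" and B B' :: "complex^'n^'k" and r :: real
  show "(A + A') ** B = A ** B + A' ** B" by (simp add: matrix_add_rdistrib_complex)
  show "A ** (B + B') = A ** B + A ** B'" by (simp add: matrix_add_ldistrib)
  show "r *\<^sub>R A ** B = r *\<^sub>R (A ** B)" by (simp add: vec_eq_iff matrix_matrix_mult_def scaleR_sum_right)
  show "A ** (r *\<^sub>R B) = r *\<^sub>R (A ** B)" by (simp add: vec_eq_iff matrix_matrix_mult_def scaleR_sum_right)
  show "\<exists>K. \<forall>(A :: complex^'k^'m) (B :: complex^'n^'k). norm (A ** B) \<le> norm A * norm B * K"
    by (intro exI[of _ 1]) (simp add: norm_matrix_mult_le)
qed

interpretation matrix_mult:
  bounded_bilinear "(**) :: complex^'k^'m \<Rightarrow> complex^'n^'k \<Rightarrow> complex^'n^'m"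
  by (rule bounded_bilinear_matrix_mult)

lemma matrix_inv_left: "invertible A \<Longrightarrow> matrix_inv A ** A = mat 1"
  and matrix_inv_right: "invertible A \<Longrightarrow> A ** matrix_inv A = mat 1"
  for A :: "complex^'m^'m"
  unfolding invertible_def matrix_inv_def by (metis (mono_tags, lifting) someI_ex)+

lemma invertible_near_identity:
  fixes A :: "complex^'m^'m"
  assumes "norm A < 1"
  shows "invertible (mat 1 + A)"
proof -
  have "inj ((*v) (mat 1 + A))"
  proof (rule injI)
    fix x y assume "(mat 1 + A) *v x = (mat 1 + A) *v y"
    then have "(mat 1 + A) *v (x - y) = 0"
      by (simp add: matrix_vector_mult_diff_distrib)
    then have eq: "x - y = - (A *v (x - y))"
      by (simp add: matrix_vector_mult_add_rdistrib eq_neg_iff_add_eq_0)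
    \<comment> \<open>Every column of \<open>c\<close> is \<open>x - y\<close>; the estimate for
      matrix products then applies to a matrix acting on a vector.\<close>
    define c :: "complex^'m^'m" where "c = (\<chi> i j. (x - y) $ i)"
    have "c = - (A ** c)"
    proof -
      have "(x - y) $ i = (- (A ** c)) $ i $ j" for i j
        by (subst eq) (simp add: c_def matrix_matrix_mult_def matrix_vector_mult_def)
      then show ?thesis by (simp add: vec_eq_iff c_def)
    qed
    then have "norm c \<le> norm A * norm c"
      by (metis norm_matrix_mult_le norm_minus_cancel)
    with assms have "norm c = 0"
      by (smt (verit) mult_less_cancel_right2 norm_ge_zero)
    then show "x = y" by (simp add: c_def vec_eq_iff)
  qed
  then show ?thesis
    using matrix_left_invertible_injective invertible_left_inverse by blast
qed

text \<open>Both bounds follow from the identity B = 1 - A B: absorbing A B on the left bounds B,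
  and inserting this again bounds B - 1. The norm of the identity remains because it exceeds 1 in
  the Frobenius norm once m > 1.\<close>

lemma norm_inverse_near_identity:
  fixes A B :: "complex^'m^'m"
  assumes "norm A \<le> q" "q \<le> 1/2" "(mat 1 + A) ** B = mat 1"
  shows "norm (B - mat 1) \<le> 2 * q * norm (mat 1 :: complex^'m^'m)"
    and "norm B \<le> 2 * norm (mat 1 :: complex^'m^'m)"
proof -
  have eq: "B = mat 1 - A ** B"
    using assms(3) by (simp add: matrix_add_rdistrib_complex algebra_simps)
  have *: "norm (A ** B) \<le> q * norm B"
    by (rule norm_matrix_mult_le_mono) (use assms in auto)
  also have "\<dots> \<le> 1/2 * norm B"
    by (rule mult_right_mono) (use assms in auto)
  finally have "norm (A ** B) \<le> norm B / 2" by simp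
  moreover have "norm B \<le> norm (mat 1 :: complex^'m^'m) + norm (A ** B)"
    using norm_triangle_ineq4[of "mat 1" "A ** B"] eq by simp
  ultimately show B: "norm B \<le> 2 * norm (mat 1 :: complex^'m^'m)" by simp
  have "norm (B - mat 1) = norm (A ** B)"
    using eq by (metis add_diff_cancel_left' diff_add_cancel norm_minus_commute)
  also have "\<dots> \<le> q * (2 * norm (mat 1 :: complex^'m^'m))"
    by (rule order_trans[OF * mult_left_mono[OF B]])
       (use assms norm_ge_zero order_trans in blast)
  finally show "norm (B - mat 1) \<le> 2 * q * norm (mat 1 :: complex^'m^'m)" by simp
qed

lemma transpose_diff: "transpose (A - B) = transpose A - transpose B"
  for A :: "complex^'n^'m"
  by (simp add: vec_eq_iff transpose_def)

lemma invertible_if_mult_eq_1: "A ** B = mat 1 \<Longrightarrow> invertible A"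
  for A B :: "complex^'m^'m"
  using invertible_right_inverse by blast

lemma norm_mat_1_ge_1: "1 \<le> norm (mat 1 :: complex^'m^'m)"
  using norm_matrix_entry_le[of "mat 1 :: complex^'m^'m" undefined undefined]
  by (simp add: mat_def)

lemma transpose_lim: "(F \<longlongrightarrow> A) net \<Longrightarrow> ((\<lambda>z. transpose (F z)) \<longlongrightarrow> transpose A) net"
  for F :: "_ \<Rightarrow> complex^'n^'m"
  unfolding transpose_def by (intro tendsto_vec_lambda tendsto_vec_nth)

section \<open>Matrix-valued holomorphic functions\<close>

definition matrix_holomorphic_on :: "(complex \<Rightarrow> complex^'m^'m) \<Rightarrow> complex set \<Rightarrow> bool" where
  "matrix_holomorphic_on F S \<longleftrightarrow> (\<forall>i j. (\<lambda>z. F z $ i $ j) holomorphic_on S)"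

lemma matrix_holomorphic_on_entry:
  "matrix_holomorphic_on F S \<Longrightarrow> (\<lambda>z. F z $ i $ j) holomorphic_on S"
  by (simp add: matrix_holomorphic_on_def)

lemma matrix_holomorphic_on_subset:
  "matrix_holomorphic_on F S \<Longrightarrow> T \<subseteq> S \<Longrightarrow> matrix_holomorphic_on F T"
  unfolding matrix_holomorphic_on_def using holomorphic_on_subset by blast

lemma matrix_holomorphic_on_cong:
  "(\<And>z. z \<in> S \<Longrightarrow> F z = G z) \<Longrightarrow> matrix_holomorphic_on F S \<longleftrightarrow> matrix_holomorphic_on G S"
  unfolding matrix_holomorphic_on_def by (auto cong: holomorphic_cong)

lemma matrix_holomorphic_on_const: "matrix_holomorphic_on (\<lambda>z. A) S"
  by (simp add: matrix_holomorphic_on_def)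

lemma matrix_holomorphic_on_add:
  "matrix_holomorphic_on F S \<Longrightarrow> matrix_holomorphic_on G S \<Longrightarrow>
     matrix_holomorphic_on (\<lambda>z. F z + G z) S"
  unfolding matrix_holomorphic_on_def by (auto intro!: holomorphic_intros)

lemma matrix_holomorphic_on_diff:
  "matrix_holomorphic_on F S \<Longrightarrow> matrix_holomorphic_on G S \<Longrightarrow>
     matrix_holomorphic_on (\<lambda>z. F z - G z) S"
  unfolding matrix_holomorphic_on_def by (auto intro!: holomorphic_intros)

lemma matrix_holomorphic_on_minus:
  "matrix_holomorphic_on F S \<Longrightarrow> matrix_holomorphic_on (\<lambda>z. - F z) S"
  unfolding matrix_holomorphic_on_def by (auto intro!: holomorphic_intros)

lemma matrix_holomorphic_on_mult:
  "matrix_holomorphic_on F S \<Longrightarrow> matrix_holomorphic_on G S \<Longrightarrow>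
     matrix_holomorphic_on (\<lambda>z. F z ** G z) S"
  unfolding matrix_holomorphic_on_def matrix_matrix_mult_def
  by (auto intro!: holomorphic_intros)

lemma matrix_holomorphic_on_transpose:
  "matrix_holomorphic_on F S \<Longrightarrow> matrix_holomorphic_on (\<lambda>z. transpose (F z)) S"
  unfolding matrix_holomorphic_on_def transpose_def by auto

lemmas matrix_holomorphic_intros =
  matrix_holomorphic_on_const matrix_holomorphic_on_add matrix_holomorphic_on_diff
  matrix_holomorphic_on_minus matrix_holomorphic_on_mult matrix_holomorphic_on_transpose

section \<open>Inverses and series of holomorphic matrix functions\<close>

lemma holomorphic_on_det:
  "matrix_holomorphic_on F S \<Longrightarrow> (\<lambda>z. det (F z)) holomorphic_on S"
  unfolding matrix_holomorphic_on_def det_def by (intro holomorphic_intros) auto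

text \<open>Column l of the inverse solves A x = e_l, so Cramer's rule applies. The quotient of
  determinants makes the holomorphy of the inverse visible.\<close>

lemma matrix_inv_entry:
  fixes A :: "complex^'m^'m"
  assumes "invertible A"
  shows "matrix_inv A $ k $ l =
    det (\<chi> i j. if j = k then (mat 1 :: complex^'m^'m) $ i $ l else A $ i $ j) / det A"
proof -
  have d: "det A \<noteq> 0" using assms by (simp add: invertible_det_nz)
  have "A *v (\<chi> i. matrix_inv A $ i $ l) = (\<chi> i. (A ** matrix_inv A) $ i $ l)"
    by (simp add: vec_eq_iff matrix_vector_mult_def matrix_matrix_mult_def)
  then have "A *v (\<chi> i. matrix_inv A $ i $ l) = (\<chi> i. (mat 1 :: complex^'m^'m) $ i $ l)"
    using matrix_inv_right[OF assms] by simp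
  from this[unfolded cramer[OF d]] show ?thesis by (simp add: vec_eq_iff cong: if_cong)
qed

lemma matrix_holomorphic_on_inverse:
  fixes F :: "complex \<Rightarrow> complex^'m^'m"
  assumes F: "matrix_holomorphic_on F S" and inv: "\<And>z. z \<in> S \<Longrightarrow> invertible (F z)"
  shows "matrix_holomorphic_on (\<lambda>z. matrix_inv (F z)) S"
  unfolding matrix_holomorphic_on_def
proof (intro allI)
  fix k l
  have "(\<lambda>z. det (\<chi> i j. if j = k then (mat 1 :: complex^'m^'m) $ i $ l else F z $ i $ j) / det (F z))
      holomorphic_on S"
  proof (intro holomorphic_on_divide holomorphic_on_det)
    show "matrix_holomorphic_on (\<lambda>z. \<chi> i j. if j = k then (mat 1 :: complex^'m^'m) $ i $ l else F z $ i $ j) S"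
      unfolding matrix_holomorphic_on_def
    proof (intro allI)
      fix i j
      show "(\<lambda>z. (\<chi> i j. if j = k then (mat 1 :: complex^'m^'m) $ i $ l else F z $ i $ j) $ i $ j)
          holomorphic_on S"
        by (cases "j = k") (use F in \<open>auto simp: matrix_holomorphic_on_def\<close>)
    qed
  qed (use F inv invertible_det_nz in auto)
  then show "(\<lambda>z. matrix_inv (F z) $ k $ l) holomorphic_on S"
    by (rule holomorphic_transform) (simp add: matrix_inv_entry inv)
qed

text \<open>Weierstrass' M-test on closed balls. The majorant may depend on the ball, since the
  bounds for the exterior series blow up at the circle of integration.\<close>

lemma matrix_holomorphic_on_suminf:
  fixes f :: "nat \<Rightarrow> complex \<Rightarrow> complex^'m^'m"
  assumes S: "open S" and hol: "\<And>k. matrix_holomorphic_on (f k) S"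
    and bound: "\<And>x. x \<in> S \<Longrightarrow>
      \<exists>d>0. \<exists>M. cball x d \<subseteq> S \<and> summable M \<and> (\<forall>k. \<forall>z\<in>cball x d. norm (f k z) \<le> M k)"
  shows "matrix_holomorphic_on (\<lambda>z. \<Sum>k. f k z) S"
  unfolding matrix_holomorphic_on_def
proof (intro allI, rule holomorphic_uniform_sequence[OF S])
  fix i j and N :: nat
  show "(\<lambda>z. (\<Sum>k<N. f k z) $ i $ j) holomorphic_on S"
    using hol by (auto simp: matrix_holomorphic_on_def intro!: holomorphic_intros)
next
  fix i j x assume "x \<in> S"
  from bound[OF this] obtain d M where *: "d > 0" "cball x d \<subseteq> S" "summable M"
    "\<And>k z. z \<in> cball x d \<Longrightarrow> norm (f k z) \<le> M k" by blast
  have "uniform_limit (cball x d) (\<lambda>N z. \<Sum>k<N. f k z) (\<lambda>z. \<Sum>k. f k z) sequentially"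
    by (rule Weierstrass_m_test) (use * in auto)
  then have "uniform_limit (cball x d) (\<lambda>N z. (\<Sum>k<N. f k z) $ i $ j)
      (\<lambda>z. (\<Sum>k. f k z) $ i $ j) sequentially"
    by (intro bounded_linear.uniform_limit[OF bounded_linear_vec_nth])
  with * show "\<exists>d>0. cball x d \<subseteq> S \<and> uniform_limit (cball x d)
      (\<lambda>N z. (\<Sum>k<N. f k z) $ i $ j) (\<lambda>z. (\<Sum>k. f k z) $ i $ j) sequentially"
    by blast
qed

section \<open>Gluing and Liouville's theorem\<close>

lemma matrix_analytic_on_if_holomorphic:
  "matrix_holomorphic_on F T \<Longrightarrow> open T \<Longrightarrow> S \<subseteq> T \<Longrightarrow> matrix_analytic_on F S"
  unfolding matrix_holomorphic_on_def matrix_analytic_on_def analytic_on_holomorphic by blast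

lemma matrix_holomorphic_on_Un:
  assumes "matrix_holomorphic_on F S" "matrix_holomorphic_on F T" "open S" "open T"
  shows "matrix_holomorphic_on F (S \<union> T)"
  using assms unfolding matrix_holomorphic_on_def by (auto intro: holomorphic_on_Un)

lemma open_annulus: "open {z :: 'a::real_normed_vector. r < norm z \<and> norm z < R}"
  by (intro open_Collect_conj open_Collect_less continuous_intros)

lemma open_norm_greater: "open {z :: 'a::real_normed_vector. r < norm z}"
  by (intro open_Collect_less continuous_intros)

lemma sums_half_powers: "(\<lambda>k. B * (1/2) ^ k) sums (2 * B)" for B :: real
  using sums_mult[OF geometric_sums[of "1/2 :: real"], of B] by (simp add: mult.commute)

text \<open>The two functions glue along the annulus to an entire function with a finite limit at
  infinity, so each entry is constant.\<close>

lemma matrix_liouville_annulus: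
  fixes H J :: "complex \<Rightarrow> complex^'m^'m"
  assumes H: "matrix_holomorphic_on H (ball 0 t)" and J: "matrix_holomorphic_on J {z. s < norm z}"
    and st: "s < t"
    and eq: "\<And>z. s < norm z \<Longrightarrow> norm z < t \<Longrightarrow> H z = J z"
    and lim: "(J \<longlongrightarrow> A) at_infinity"
  shows "norm z < t \<Longrightarrow> H z = A" and "s < norm z \<Longrightarrow> J z = A"
proof -
  define \<Phi> where "\<Phi> z = (if norm z < t then H z else J z)" for z
  have \<Phi>_J: "\<Phi> z = J z" if "s < norm z" for z
    using that by (simp add: \<Phi>_def eq)
  have "matrix_holomorphic_on \<Phi> (ball 0 t)"
    using H by (subst matrix_holomorphic_on_cong[where G = H]) (auto simp: \<Phi>_def)
  moreover have "matrix_holomorphic_on \<Phi> {z. s < norm z}"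
    using J by (subst matrix_holomorphic_on_cong[where G = J]) (auto simp: \<Phi>_J)
  ultimately have "matrix_holomorphic_on \<Phi> (ball 0 t \<union> {z. s < norm z})"
    by (intro matrix_holomorphic_on_Un open_ball open_norm_greater)
  moreover have "ball 0 t \<union> {z. s < norm z} = (UNIV :: complex set)" using st by auto
  ultimately have hol: "matrix_holomorphic_on \<Phi> UNIV" by simp
  have "\<forall>\<^sub>F z in at_infinity. J z = \<Phi> z"
    unfolding eventually_at_infinity using \<Phi>_J by (intro exI[of _ "s + 1"]) auto
  with lim have "(\<Phi> \<longlongrightarrow> A) at_infinity" by (rule Lim_transform_eventually)
  then have "\<Phi> z $ i $ j = A $ i $ j" for z i j
    by (intro Liouville_weak matrix_holomorphic_on_entry[OF hol] tendsto_vec_nth)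
  then have \<Phi>: "\<Phi> z = A" for z by (simp add: vec_eq_iff)
  show "norm z < t \<Longrightarrow> H z = A" using \<Phi>[of z] by (simp add: \<Phi>_def)
  show "s < norm z \<Longrightarrow> J z = A" using \<Phi>[of z] by (simp add: \<Phi>_J)
qed

section \<open>Cauchy integrals over circles around the origin\<close>

text \<open>For h holomorphic on an annulus containing the circle, this is the part of the Laurent
  series with nonnegative powers if \<open>norm z < s\<close>, and minus the part with negative
  powers if \<open>norm z > s\<close>, each continued to the full disc or exterior.\<close>

definition cauchy_transform :: "real \<Rightarrow> (complex \<Rightarrow> complex) \<Rightarrow> complex \<Rightarrow> complex" where
  "cauchy_transform s h z =
     contour_integral (circlepath 0 s) (\<lambda>w. h w / (w - z)) / (2 * of_real pi * \<i>)"

definition matrix_cauchy_transform ::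
    "real \<Rightarrow> (complex \<Rightarrow> complex^'m^'m) \<Rightarrow> complex \<Rightarrow> complex^'m^'m" where
  "matrix_cauchy_transform s H z = (\<chi> i j. cauchy_transform s (\<lambda>w. H w $ i $ j) z)"

lemma contour_integrable_cauchy_kernel:
  assumes "s > 0" "continuous_on (sphere 0 s) h" "norm z \<noteq> s"
  shows "(\<lambda>w. h w / (w - z)) contour_integrable_on circlepath 0 s"
  by (rule contour_integrable_continuous_circlepath)
     (use assms in \<open>auto intro!: continuous_intros\<close>)

lemma holomorphic_on_cauchy_transform:
  assumes "s > 0" "continuous_on (sphere 0 s) h"
  shows "cauchy_transform s h holomorphic_on - sphere 0 s"
proof -
  \<comment> \<open>Differentiation under the integral sign; \<open>of_nat 1\<close> and
    \<open>Suc 1\<close> display the case of exponent 1 of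
    \<open>Cauchy_next_derivative\<close>.\<close>
  have "((\<lambda>z. contour_integral (circlepath 0 s) (\<lambda>w. h w / (w - z))) has_field_derivative
      of_nat 1 * contour_integral (circlepath 0 s) (\<lambda>w. h w / (w - z) ^ Suc 1)) (at z)"
    if "z \<in> - sphere 0 s" for z
  proof (rule Cauchy_next_derivative(2)[where S = UNIV and B = "2 * pi * s"])
    show "norm (vector_derivative (circlepath 0 s) (at t)) \<le> 2 * pi * s" if "t \<in> {0..1}" for t
      using assms by (simp add: vector_derivative_circlepath norm_mult)
    fix w assume "w \<in> UNIV - path_image (circlepath 0 s)"
    then have "norm w \<noteq> s" using assms by auto
    from has_contour_integral_integral[OF contour_integrable_cauchy_kernel[OF assms this]]
    show "((\<lambda>u. h u / (u - w) ^ 1) has_contour_integral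
        contour_integral (circlepath 0 s) (\<lambda>u. h u / (u - w))) (circlepath 0 s)"
      by simp
  qed (use assms that in auto)
  then have "(\<lambda>z. contour_integral (circlepath 0 s) (\<lambda>w. h w / (w - z))) holomorphic_on - sphere 0 s"
    by (subst holomorphic_on_open) (blast intro: open_Compl closed_sphere)+
  then show ?thesis
    unfolding cauchy_transform_def by (intro holomorphic_intros) auto
qed

text \<open>The hypothesis compares \<open>h w\<close> with \<open>norm (w - z)\<close> so that a
  density vanishing at z can cancel the Cauchy kernel; no distance from z to the circle then enters
  the estimate.\<close>

lemma norm_cauchy_transform_le:
  assumes s: "s > 0" and h: "continuous_on (sphere 0 s) h" and z: "norm z \<noteq> s"
    and bound: "\<And>w. norm w = s \<Longrightarrow> norm (h w) \<le> B * norm (w - z)"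
  shows "norm (cauchy_transform s h z) \<le> s * B"
proof -
  have "0 \<le> norm (h (of_real s))" by simp
  also have "\<dots> \<le> B * norm (of_real s - z)" by (rule bound) (use s in auto)
  finally have B: "B \<ge> 0"
    using z s by (smt (verit) norm_eq_zero norm_of_real right_minus_eq zero_le_mult_iff zero_less_norm_iff)
  have "norm (contour_integral (circlepath 0 s) (\<lambda>w. h w / (w - z))) \<le> B * (2 * pi * s)"
  proof (rule has_contour_integral_bound_circlepath)
    show "((\<lambda>w. h w / (w - z)) has_contour_integral
        contour_integral (circlepath 0 s) (\<lambda>w. h w / (w - z))) (circlepath 0 s)"
      by (rule has_contour_integral_integral) (rule contour_integrable_cauchy_kernel[OF s h z])
    fix w :: complex assume "norm (w - 0) = s"
    then show "norm (h w / (w - z)) \<le> B"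
      using bound[of w] z B by (auto simp: norm_divide divide_simps)
  qed (use s B in auto)
  then show ?thesis
    unfolding cauchy_transform_def by (simp add: norm_divide norm_mult field_simps)
qed

text \<open>Both circles have the same argument at each parameter, so the straight-line homotopy
  moves along radii and stays in the annulus.\<close>

lemma contour_integral_concentric_circles_eq:
  assumes f: "f holomorphic_on {z. r < norm z \<and> norm z < R}"
    and r: "0 \<le> r" "r < s" "s \<le> t" "t < R"
  shows "contour_integral (circlepath 0 t) f = contour_integral (circlepath 0 s) f"
proof (rule Cauchy_theorem_homotopic_loops[OF _ _ f])
  show "open {z :: complex. r < norm z \<and> norm z < R}"
    by (intro open_Collect_conj open_Collect_less continuous_intros)
  show "homotopic_loops {z. r < norm z \<and> norm z < R} (circlepath 0 t) (circlepath 0 s)"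
  proof (rule homotopic_loops_linear)
    fix x :: real
    show "closed_segment (circlepath 0 t x) (circlepath 0 s x) \<subseteq> {z. r < norm z \<and> norm z < R}"
    proof
      fix w assume "w \<in> closed_segment (circlepath 0 t x) (circlepath 0 s x)"
      then obtain u where u: "0 \<le> u" "u \<le> 1"
        "w = (1 - u) *\<^sub>R circlepath 0 t x + u *\<^sub>R circlepath 0 s x"
        by (auto simp: closed_segment_def)
      then have "w = of_real ((1 - u) * t + u * s) * exp (2 * of_real pi * \<i> * of_real x)"
        by (simp add: circlepath scaleR_conv_of_real algebra_simps)
      then have nw: "norm w = \<bar>(1 - u) * t + u * s\<bar>"
        by (simp add: norm_mult norm_exp_eq_Re del: of_real_add of_real_mult of_real_diff)
      have "(1 - u) * s \<le> (1 - u) * t" "u * s \<le> u * t"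
        using u r by (auto intro!: mult_left_mono)
      then have "s \<le> (1 - u) * t + u * s" "(1 - u) * t + u * s \<le> t"
        by (auto simp: algebra_simps)
      with nw r show "w \<in> {z. r < norm z \<and> norm z < R}" by auto
    qed
  qed auto
qed auto

text \<open>The difference quotient of h at z has a removable singularity, so its integrals over the
  two circles agree. What is left is h z times the difference of the winding numbers, 1 and
  0.\<close>

lemma cauchy_transform_jump:
  assumes h: "h holomorphic_on {z. r < norm z \<and> norm z < R}"
    and r: "0 \<le> r" "r < s" "s < norm z" "norm z < t" "t < R"
  shows "cauchy_transform t h z - cauchy_transform s h z = h z"
proof -
  let ?A = "{z. r < norm z \<and> norm z < R} :: complex set"
  define q where "q = (\<lambda>w. if w = z then deriv h z else (h w - h z) / (w - z))"
  have A: "open ?A"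
    by (intro open_Collect_conj open_Collect_less continuous_intros)
  have "q holomorphic_on ?A"
    unfolding q_def by (rule pole_lemma_open[OF h A])
  then have eq: "contour_integral (circlepath 0 t) q = contour_integral (circlepath 0 s) q"
    by (rule contour_integral_concentric_circles_eq) (use r in auto)
  have hc: "continuous_on (sphere 0 u) h" if "r < u" "u < R" for u
    using holomorphic_on_imp_continuous_on[OF h]
    by (rule continuous_on_subset) (use that in auto)
  have split: "contour_integral (circlepath 0 u) (\<lambda>w. h w / (w - z)) =
      contour_integral (circlepath 0 u) q + h z * contour_integral (circlepath 0 u) (\<lambda>w. 1 / (w - z))"
    if u: "r < u" "u < R" "norm z \<noteq> u" for u
  proof -
    have "u > 0" using r u by auto
    have "contour_integral (circlepath 0 u) q =
        contour_integral (circlepath 0 u) (\<lambda>w. h w / (w - z) - h z * (1 / (w - z)))"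
      by (rule contour_integral_eq) (use \<open>u > 0\<close> u in \<open>auto simp: q_def diff_divide_distrib\<close>)
    also have "\<dots> = contour_integral (circlepath 0 u) (\<lambda>w. h w / (w - z)) -
        contour_integral (circlepath 0 u) (\<lambda>w. h z * (1 / (w - z)))"
      by (intro contour_integral_diff contour_integrable_lmul contour_integrable_cauchy_kernel hc)
         (use \<open>u > 0\<close> u in auto)
    also have "contour_integral (circlepath 0 u) (\<lambda>w. h z * (1 / (w - z))) =
        h z * contour_integral (circlepath 0 u) (\<lambda>w. 1 / (w - z))"
      by (intro contour_integral_lmul contour_integrable_cauchy_kernel)
         (use \<open>u > 0\<close> u in auto)
    finally show ?thesis by simp
  qed
  have 1: "contour_integral (circlepath 0 t) (\<lambda>w. 1 / (w - z)) = 2 * of_real pi * \<i>"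
    using Cauchy_integral_circlepath_simple[of "\<lambda>_. 1" 0 t z] r
    by (auto intro!: contour_integral_unique)
  have 0: "contour_integral (circlepath 0 s) (\<lambda>w. 1 / (w - z)) = 0"
  proof (rule contour_integral_unique, rule Cauchy_theorem_disc_simple)
    show "(\<lambda>w. 1 / (w - z)) holomorphic_on ball 0 (norm z)"
      by (intro holomorphic_intros) auto
  qed (use r in auto)
  show ?thesis
    unfolding cauchy_transform_def using r
    by (simp add: split 0 1 eq flip: diff_divide_distrib)
qed

section \<open>Entrywise transfer to matrices\<close>

definition matrix_continuous_on where
  "matrix_continuous_on S H \<longleftrightarrow> (\<forall>i j. continuous_on S (\<lambda>z. (H z :: complex^'m^'m) $ i $ j))"

lemma matrix_holomorphic_on_imp_continuous_on:
  "matrix_holomorphic_on F S \<Longrightarrow> T \<subseteq> S \<Longrightarrow> matrix_continuous_on T F"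
  unfolding matrix_holomorphic_on_def matrix_continuous_on_def
  using holomorphic_on_imp_continuous_on continuous_on_subset by blast

lemma matrix_holomorphic_on_cauchy_transform:
  assumes "s > 0" "matrix_continuous_on (sphere 0 s) H"
  shows "matrix_holomorphic_on (matrix_cauchy_transform s H) (- sphere 0 s)"
  using assms holomorphic_on_cauchy_transform
  by (auto simp: matrix_holomorphic_on_def matrix_continuous_on_def matrix_cauchy_transform_def)

lemma norm_matrix_cauchy_transform_le:
  fixes H :: "complex \<Rightarrow> complex^'m^'m"
  assumes "s > 0" "matrix_continuous_on (sphere 0 s) H" "norm z \<noteq> s"
    and "\<And>w. norm w = s \<Longrightarrow> norm (H w) \<le> B * norm (w - z)"
  shows "norm (matrix_cauchy_transform s H z) \<le> (real CARD('m))\<^sup>2 * (s * B)"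
proof (rule norm_matrix_le_entries)
  fix i j
  have "norm (H w $ i $ j) \<le> B * norm (w - z)" if "norm w = s" for w
    using assms(4)[OF that] norm_matrix_entry_le order_trans by blast
  with assms(1-3) show "norm (matrix_cauchy_transform s H z $ i $ j) \<le> s * B"
    by (simp add: matrix_cauchy_transform_def matrix_continuous_on_def norm_cauchy_transform_le)
qed

text \<open>Used to bring the outer factor \<open>E z\<close> under the integral, where it meets
  \<open>E' w\<close>.\<close>

lemma matrix_cauchy_transform_mult_right:
  assumes s: "s > 0" and H: "matrix_continuous_on (sphere 0 s) H" and z: "norm z \<noteq> s"
  shows "matrix_cauchy_transform s H z ** A = matrix_cauchy_transform s (\<lambda>w. H w ** A) z"
proof -
  have "contour_integral (circlepath 0 s) (\<lambda>w. (\<Sum>k\<in>UNIV. H w $ i $ k * A $ k $ j) / (w - z)) =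
      (\<Sum>k\<in>UNIV. contour_integral (circlepath 0 s) (\<lambda>w. H w $ i $ k / (w - z)) * A $ k $ j)" for i j
  proof -
    have int: "(\<lambda>w. H w $ i $ k / (w - z)) contour_integrable_on circlepath 0 s" for k
      by (rule contour_integrable_cauchy_kernel[OF s _ z])
         (use H in \<open>auto simp: matrix_continuous_on_def\<close>)
    have "contour_integral (circlepath 0 s) (\<lambda>w. (\<Sum>k\<in>UNIV. H w $ i $ k * A $ k $ j) / (w - z)) =
        contour_integral (circlepath 0 s) (\<lambda>w. \<Sum>k\<in>UNIV. H w $ i $ k / (w - z) * A $ k $ j)"
      by (simp add: sum_divide_distrib)
    also have "\<dots> = (\<Sum>k\<in>UNIV. contour_integral (circlepath 0 s)
        (\<lambda>w. H w $ i $ k / (w - z) * A $ k $ j))"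
      by (intro contour_integral_sum contour_integrable_rmul int) auto
    finally show ?thesis
      by (simp only: contour_integral_rmul[OF int])
  qed
  then show ?thesis
    by (simp add: vec_eq_iff matrix_cauchy_transform_def cauchy_transform_def
        matrix_matrix_mult_def sum_divide_distrib)
qed

lemma matrix_cauchy_transform_jump:
  assumes "matrix_holomorphic_on H {z. r < norm z \<and> norm z < R}"
    and "0 \<le> r" "r < s" "s < norm z" "norm z < t" "t < R"
  shows "matrix_cauchy_transform t H z - matrix_cauchy_transform s H z = H z"
  using assms
  by (simp add: vec_eq_iff matrix_cauchy_transform_def matrix_holomorphic_on_def
      cauchy_transform_jump[where r = r and R = R])

section \<open>Factorization on the disc and its exterior\<close>

text \<open>\<open>E'\<close> is the inverse of \<open>E\<close>, kept as separate data so that the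
  locale can be instantiated with transposes. In the application \<open>\<kappa>\<close> is of order
  n^(a-b) and \<open>\<eta>\<close> of order n^(e-a); dividing \<open>\<eta>\<close> by
  \<open>\<rho>\<close> in \<open>kernel\<close> frees the condition \<open>small\<close> of
  \<open>\<rho>\<close>. The annulus begins at \<rho>/4 to leave room inside the contour of radius
  \<rho>/2.\<close>

locale small_jump =
  fixes E E' K :: "complex \<Rightarrow> complex^'m^'m" and \<rho> \<kappa> \<eta> B B' :: real
  assumes \<rho>_pos: "\<rho> > 0"
    and E_hol: "matrix_holomorphic_on E (ball 0 \<rho>)"
    and E'_hol: "matrix_holomorphic_on E' (ball 0 \<rho>)"
    and E'_E: "\<And>z. norm z < \<rho> \<Longrightarrow> E' z ** E z = mat 1"
    and K_hol: "matrix_holomorphic_on K {z. \<rho> / 4 < norm z \<and> norm z < \<rho>}"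
    and K_bound: "\<And>z. \<rho> / 2 \<le> norm z \<Longrightarrow> norm z \<le> 3 / 4 * \<rho> \<Longrightarrow> norm (K z) \<le> \<kappa>"
    and kernel: "\<And>w z. norm w < \<rho> \<Longrightarrow> norm z \<le> \<rho> \<Longrightarrow>
                   norm (E' w ** E z - mat 1) \<le> \<eta> / \<rho> * norm (w - z)"
    and E_bound: "\<And>z. norm z \<le> \<rho> \<Longrightarrow> norm (E z) \<le> B"
    and E'_bound: "\<And>z. norm z < \<rho> \<Longrightarrow> norm (E' z) \<le> B'"
    and \<eta>_nonneg: "\<eta> \<ge> 0"
    and small: "16 * (real CARD('m))\<^sup>2 * \<kappa> * (1 + \<eta>) \<le> 1"
begin

abbreviation jump_density where
  "jump_density f \<equiv> \<lambda>w. f w ** K w ** E' w"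

text \<open>The part of f K E' with negative powers, in its Laurent expansion on the annulus. The
  sign is the one with which a contour inside z enters the jump formula.\<close>

definition exterior_part :: "(complex \<Rightarrow> complex^'m^'m) \<Rightarrow> complex \<Rightarrow> complex^'m^'m" where
  "exterior_part f z = - matrix_cauchy_transform (\<rho> / 2) (jump_density f) z"

text \<open>Both branches express minus the nonnegative part of f K E', times E. Switching at 5/8,
  midway between 1/2 and 3/4, keeps z at distance at least \<rho>/8 from the contour in use.\<close>

definition step :: "(complex \<Rightarrow> complex^'m^'m) \<Rightarrow> complex \<Rightarrow> complex^'m^'m" where
  "step f z = (if norm z < 5 / 8 * \<rho>
     then - (matrix_cauchy_transform (3 / 4 * \<rho>) (jump_density f) z ** E z)
     else exterior_part f z ** E z - f z ** K z)"

definition approx :: "nat \<Rightarrow> complex \<Rightarrow> complex^'m^'m" where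
  "approx k = (step ^^ k) E"

definition interior_factor :: "complex \<Rightarrow> complex^'m^'m" where
  "interior_factor z = (\<Sum>k. approx k z)"

definition exterior_factor :: "complex \<Rightarrow> complex^'m^'m" where
  "exterior_factor z = mat 1 + (\<Sum>k. exterior_part (approx k) z)"

lemma \<kappa>_nonneg: "\<kappa> \<ge> 0"
proof -
  have "norm (K (of_real (\<rho> / 2))) \<le> \<kappa>" using \<rho>_pos by (intro K_bound) auto
  then show ?thesis using norm_ge_zero order_trans by blast
qed

lemma B_nonneg: "B \<ge> 0" and B'_nonneg: "B' \<ge> 0"
  using E_bound[of 0] E'_bound[of 0] \<rho>_pos norm_ge_zero order_trans
  by (metis less_imp_le norm_zero)+

section \<open>One step of the iteration\<close>

context
  fixes f :: "complex \<Rightarrow> complex^'m^'m"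
  assumes f: "matrix_holomorphic_on f (ball 0 \<rho>)"
begin

lemma jump_density_hol: "matrix_holomorphic_on (jump_density f) {z. \<rho> / 4 < norm z \<and> norm z < \<rho>}"
  by (intro matrix_holomorphic_on_mult K_hol matrix_holomorphic_on_subset[OF f]
      matrix_holomorphic_on_subset[OF E'_hol]) auto

lemma jump_density_continuous:
  "\<rho> / 4 < s \<Longrightarrow> s < \<rho> \<Longrightarrow> matrix_continuous_on (sphere 0 s) (jump_density f)"
  by (rule matrix_holomorphic_on_imp_continuous_on[OF jump_density_hol]) auto

lemma exterior_part_hol: "matrix_holomorphic_on (exterior_part f) {z. \<rho> / 2 < norm z}"
proof -
  have "matrix_holomorphic_on (matrix_cauchy_transform (\<rho> / 2) (jump_density f)) (- sphere 0 (\<rho> / 2))"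
    by (rule matrix_holomorphic_on_cauchy_transform) (use \<rho>_pos jump_density_continuous in auto)
  then show ?thesis
    unfolding exterior_part_def
    by (intro matrix_holomorphic_on_minus) (auto elim: matrix_holomorphic_on_subset)
qed

text \<open>Where z lies between the contours, the jump formula exchanges one for the other at the
  price of f K E', and \<open>E'_E\<close> reduces this term to f K. Summed over the iterates, the
  identity becomes the factorization.\<close>

lemma step_eq_exterior:
  assumes "\<rho> / 2 < norm z" "norm z < \<rho>"
  shows "step f z = exterior_part f z ** E z - f z ** K z"
proof (cases "norm z < 5 / 8 * \<rho>")
  case True
  have "matrix_cauchy_transform (3 / 4 * \<rho>) (jump_density f) z -
      matrix_cauchy_transform (\<rho> / 2) (jump_density f) z = jump_density f z"
    by (rule matrix_cauchy_transform_jump[OF jump_density_hol]) (use True assms \<rho>_pos in auto)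
  then have "matrix_cauchy_transform (3 / 4 * \<rho>) (jump_density f) z =
      jump_density f z - exterior_part f z"
    by (simp add: exterior_part_def algebra_simps)
  then show ?thesis
    using True assms E'_E[of z]
    by (simp add: step_def matrix_mult.diff_left flip: matrix_mul_assoc)
qed (simp add: step_def)

lemma step_eq_interior:
  assumes "norm z < 3 / 4 * \<rho>"
  shows "step f z = - (matrix_cauchy_transform (3 / 4 * \<rho>) (jump_density f) z ** E z)"
proof (cases "norm z < 5 / 8 * \<rho>")
  case False
  have "matrix_cauchy_transform (3 / 4 * \<rho>) (jump_density f) z -
      matrix_cauchy_transform (\<rho> / 2) (jump_density f) z = jump_density f z"
    by (rule matrix_cauchy_transform_jump[OF jump_density_hol]) (use False assms \<rho>_pos in auto)
  then have "matrix_cauchy_transform (3 / 4 * \<rho>) (jump_density f) z =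
      jump_density f z - exterior_part f z"
    by (simp add: exterior_part_def algebra_simps)
  then show ?thesis
    using False assms E'_E[of z] \<rho>_pos
    by (simp add: step_def matrix_mult.diff_left flip: matrix_mul_assoc)
qed (simp add: step_def)

text \<open>The two formulas for \<open>step\<close> are valid on overlapping open sets, a disc of
  radius 3\<rho>/4 and an annulus beyond \<rho>/2, so the case distinction at 5/8 leaves no
  seam.\<close>

lemma step_hol: "matrix_holomorphic_on (step f) (ball 0 \<rho>)"
proof -
  have "matrix_holomorphic_on (matrix_cauchy_transform (3 / 4 * \<rho>) (jump_density f))
      (- sphere 0 (3 / 4 * \<rho>))"
    by (rule matrix_holomorphic_on_cauchy_transform) (use \<rho>_pos jump_density_continuous in auto)
  then have "matrix_holomorphic_on
      (\<lambda>z. - (matrix_cauchy_transform (3 / 4 * \<rho>) (jump_density f) z ** E z)) (ball 0 (3 / 4 * \<rho>))"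
    by (intro matrix_holomorphic_on_minus matrix_holomorphic_on_mult
        matrix_holomorphic_on_subset[OF E_hol]) (use \<rho>_pos in \<open>auto elim: matrix_holomorphic_on_subset\<close>)
  then have 1: "matrix_holomorphic_on (step f) (ball 0 (3 / 4 * \<rho>))"
    by (subst matrix_holomorphic_on_cong[OF step_eq_interior]) auto
  have "matrix_holomorphic_on (\<lambda>z. exterior_part f z ** E z - f z ** K z)
      {z. \<rho> / 2 < norm z \<and> norm z < \<rho>}"
    by (intro matrix_holomorphic_on_diff matrix_holomorphic_on_mult
        matrix_holomorphic_on_subset[OF f] matrix_holomorphic_on_subset[OF E_hol]
        matrix_holomorphic_on_subset[OF K_hol] matrix_holomorphic_on_subset[OF exterior_part_hol])
       (use \<rho>_pos in auto)
  then have 2: "matrix_holomorphic_on (step f) {z. \<rho> / 2 < norm z \<and> norm z < \<rho>}"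
    by (subst matrix_holomorphic_on_cong[OF step_eq_exterior]) auto
  have "ball 0 (3 / 4 * \<rho>) \<union> {z. \<rho> / 2 < norm z \<and> norm z < \<rho>} = (ball 0 \<rho> :: complex set)"
    using \<rho>_pos by auto
  with matrix_holomorphic_on_Un[OF 1 2 open_ball open_annulus] show ?thesis by simp
qed

context
  fixes M :: real
  assumes f_bound: "\<And>z. norm z \<le> 3 / 4 * \<rho> \<Longrightarrow> norm (f z) \<le> M"
begin

lemma M_nonneg: "M \<ge> 0"
  using f_bound[of 0] \<rho>_pos norm_ge_zero order_trans by (metis norm_zero less_imp_le mult_pos_pos
      zero_less_divide_iff zero_less_numeral)

text \<open>The one estimate in which E' and E compensate each other: the constants \<open>B\<close>
  and \<open>B'\<close> do not appear. The circles of both radii are covered, for z on either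
  side.\<close>

lemma norm_cauchy_density_mult_le:
  assumes s: "\<rho> / 2 \<le> s" "s \<le> 3 / 4 * \<rho>" and z: "norm z \<le> \<rho>" "\<bar>norm z - s\<bar> \<ge> \<rho> / 8"
  shows "norm (matrix_cauchy_transform s (jump_density f) z ** E z)
    \<le> 6 * (real CARD('m))\<^sup>2 * \<kappa> * (1 + \<eta>) * M"
proof -
  have s0: "s > 0" "s < \<rho>" "\<rho> / 4 < s" "norm z \<noteq> s" using s z \<rho>_pos by auto
  have cont: "matrix_continuous_on (sphere 0 s) (jump_density f)"
    by (rule jump_density_continuous) (use s0 in auto)
  have cont': "matrix_continuous_on (sphere 0 s) (\<lambda>w. jump_density f w ** E z)"
    by (rule matrix_holomorphic_on_imp_continuous_on
        [OF matrix_holomorphic_on_mult[OF jump_density_hol matrix_holomorphic_on_const]])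
       (use s0 in auto)
  have bound: "norm (jump_density f w ** E z) \<le> (M * \<kappa> * (8 + \<eta>) / \<rho>) * norm (w - z)"
    if w: "norm w = s" for w
  proof -
    have fK: "norm (f w ** K w) \<le> M * \<kappa>"
      by (rule norm_matrix_mult_le_mono) (use f_bound K_bound w s in auto)
    have "\<bar>norm z - norm w\<bar> \<le> norm (w - z)"
      using norm_triangle_ineq3[of z w] by (simp add: norm_minus_commute)
    \<comment> \<open>The summand f K lacks the factor w - z; the distance \<rho>/8 from the contour
      brings it to the same form.\<close>
    with z w have d: "8 / \<rho> * norm (w - z) \<ge> 1" using \<rho>_pos by (simp add: field_simps)
    have "jump_density f w ** E z = f w ** K w + f w ** K w ** (E' w ** E z - mat 1)"
      by (simp add: matrix_mult.diff_right matrix_mul_assoc)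
    also have "norm \<dots> \<le> norm (f w ** K w) + norm (f w ** K w ** (E' w ** E z - mat 1))"
      by (rule norm_triangle_ineq)
    also have "\<dots> \<le> M * \<kappa> + M * \<kappa> * (\<eta> / \<rho> * norm (w - z))"
      by (intro add_mono norm_matrix_mult_le_mono[OF fK] fK kernel) (use w s0 z in auto)
    also have "\<dots> \<le> M * \<kappa> * (8 / \<rho> * norm (w - z)) + M * \<kappa> * (\<eta> / \<rho> * norm (w - z))"
      using mult_left_mono[OF d, of "M * \<kappa>"] M_nonneg \<kappa>_nonneg by simp
    also have "\<dots> = (M * \<kappa> * (8 + \<eta>) / \<rho>) * norm (w - z)"
      by (simp add: field_simps add_divide_distrib)
    finally show ?thesis .
  qed
  have "norm (matrix_cauchy_transform s (jump_density f) z ** E z) =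
      norm (matrix_cauchy_transform s (\<lambda>w. jump_density f w ** E z) z)"
    by (simp add: matrix_cauchy_transform_mult_right[OF s0(1) cont s0(4)])
  also have "\<dots> \<le> (real CARD('m))\<^sup>2 * (s * (M * \<kappa> * (8 + \<eta>) / \<rho>))"
    by (rule norm_matrix_cauchy_transform_le) (use s0 cont' bound in auto)
  \<comment> \<open>With 8 + \<eta> at most 8 (1 + \<eta>) and s at most 3\<rho>/4, the constant
    becomes 8 * 3/4 = 6.\<close>
  also have "\<dots> \<le> (real CARD('m))\<^sup>2 * (3 / 4 * \<rho> * (M * \<kappa> * (8 * (1 + \<eta>)) / \<rho>))"
    using s s0 M_nonneg \<kappa>_nonneg \<eta>_nonneg \<rho>_pos
    by (intro mult_left_mono mult_mono divide_right_mono) auto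
  also have "\<dots> = 6 * (real CARD('m))\<^sup>2 * \<kappa> * (1 + \<eta>) * M"
    using \<rho>_pos by (simp add: field_simps)
  finally show ?thesis .
qed

text \<open>By \<open>small\<close> the Cauchy term takes at most 6/16 of M and the term f K at most
  1/16, together less than one half.\<close>

lemma small_factor: "6 * (real CARD('m))\<^sup>2 * \<kappa> * (1 + \<eta>) * M + M * \<kappa> \<le> M / 2"
proof -
  have "1 \<le> (real CARD('m))\<^sup>2" by (simp add: Suc_leI)
  then have "\<kappa> * 1 * 1 \<le> \<kappa> * (real CARD('m))\<^sup>2 * (1 + \<eta>)"
    using \<kappa>_nonneg \<eta>_nonneg by (intro mult_mono) auto
  then have "6 * (real CARD('m))\<^sup>2 * \<kappa> * (1 + \<eta>) + \<kappa> \<le> 1 / 2"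
    using small by (simp add: mult_ac)
  from mult_right_mono[OF this M_nonneg] show ?thesis by (simp add: algebra_simps)
qed

text \<open>Needed up to the circle of radius \<rho>, beyond the disc on which the iterates are
  bounded. Only the product with \<open>E z\<close> can be this small, since the cancellation under
  the integral needs that factor.\<close>

lemma norm_exterior_part_mult_le:
  assumes "5 / 8 * \<rho> \<le> norm z" "norm z \<le> \<rho>"
  shows "norm (exterior_part f z ** E z) \<le> M / 2"
proof -
  have "norm (exterior_part f z ** E z) \<le> 6 * (real CARD('m))\<^sup>2 * \<kappa> * (1 + \<eta>) * M"
    unfolding exterior_part_def matrix_mult.minus_left norm_minus_cancel
    by (rule norm_cauchy_density_mult_le) (use assms \<rho>_pos in auto)
  moreover have "0 \<le> M * \<kappa>" using M_nonneg \<kappa>_nonneg by simp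
  ultimately show ?thesis using small_factor by linarith
qed

text \<open>The disc of radius 3\<rho>/4 contains both contours, so a bound there is all the next
  step asks for and the contraction can be iterated.\<close>

lemma norm_step_le:
  assumes "norm z \<le> 3 / 4 * \<rho>"
  shows "norm (step f z) \<le> M / 2"
proof (cases "norm z < 5 / 8 * \<rho>")
  case True
  then have "norm (step f z) \<le> 6 * (real CARD('m))\<^sup>2 * \<kappa> * (1 + \<eta>) * M"
    unfolding step_def
    by (simp only: if_True norm_minus_cancel) (rule norm_cauchy_density_mult_le, use \<rho>_pos in auto)
  moreover have "0 \<le> M * \<kappa>" using M_nonneg \<kappa>_nonneg by simp
  ultimately show ?thesis using small_factor by linarith
next
  case False
  have "norm (exterior_part f z ** E z) \<le> 6 * (real CARD('m))\<^sup>2 * \<kappa> * (1 + \<eta>) * M"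
    unfolding exterior_part_def matrix_mult.minus_left norm_minus_cancel
    by (rule norm_cauchy_density_mult_le) (use False assms \<rho>_pos in auto)
  moreover have "norm (f z ** K z) \<le> M * \<kappa>"
    by (rule norm_matrix_mult_le_mono) (use assms False \<rho>_pos f_bound K_bound in auto)
  moreover have "norm (step f z) \<le> norm (exterior_part f z ** E z) + norm (f z ** K z)"
    using False by (simp add: step_def norm_triangle_ineq4)
  ultimately show ?thesis using small_factor by linarith
qed

text \<open>Far outside the disc there is no factor \<open>E z\<close> to compensate E', which is
  therefore bounded separately by \<open>B'\<close>. In return the estimate decays as z tends to
  infinity.\<close>

lemma norm_exterior_part_le:
  assumes "\<rho> / 2 < norm z"
  shows "norm (exterior_part f z) \<le> (real CARD('m))\<^sup>2 * \<rho> * \<kappa> * B' * (M / 2) / (norm z - \<rho> / 2)"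
proof -
  have "norm (matrix_cauchy_transform (\<rho> / 2) (jump_density f) z)
      \<le> (real CARD('m))\<^sup>2 * (\<rho> / 2 * (M * \<kappa> * B' / (norm z - \<rho> / 2)))"
  proof (rule norm_matrix_cauchy_transform_le)
    fix w :: complex assume w: "norm w = \<rho> / 2"
    have "norm (jump_density f w) \<le> M * \<kappa> * B'"
      by (intro norm_matrix_mult_le_mono f_bound K_bound E'_bound) (use w \<rho>_pos in auto)
    also have "\<dots> \<le> M * \<kappa> * B' / (norm z - \<rho> / 2) * norm (w - z)"
    proof -
      have "norm z - \<rho> / 2 \<le> norm (w - z)"
        using norm_triangle_ineq2[of z w] w by (simp add: norm_minus_commute)
      then have "1 \<le> norm (w - z) / (norm z - \<rho> / 2)" using assms by simp
      from mult_left_mono[OF this, of "M * \<kappa> * B'"] show ?thesis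
        using M_nonneg \<kappa>_nonneg B'_nonneg by simp
    qed
    finally show "norm (jump_density f w) \<le> M * \<kappa> * B' / (norm z - \<rho> / 2) * norm (w - z)" .
  qed (use assms \<rho>_pos jump_density_continuous in auto)
  then show ?thesis by (simp add: exterior_part_def mult_ac)
qed

end

end

section \<open>Summation of the iterates\<close>

lemma approx_0: "approx 0 = E" and approx_Suc: "approx (Suc k) = step (approx k)"
  by (simp_all add: approx_def)

lemma approx_hol: "matrix_holomorphic_on (approx k) (ball 0 \<rho>)"
  by (induction k) (simp_all add: approx_0 approx_Suc E_hol step_hol)

lemma norm_approx_le: "norm z \<le> 3 / 4 * \<rho> \<Longrightarrow> norm (approx k z) \<le> B * (1/2) ^ k"
proof (induction k arbitrary: z)
  case 0
  then show ?case using E_bound[of z] \<rho>_pos by (simp add: approx_0)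
next
  case (Suc k)
  from norm_step_le[OF approx_hol Suc.IH Suc.prems] show ?case
    by (simp add: approx_Suc)
qed

lemma summable_approx: "norm z \<le> 3 / 4 * \<rho> \<Longrightarrow> summable (\<lambda>k. approx k z)"
  by (rule summable_comparison_test'[OF sums_summable[OF sums_half_powers[of B]]])
     (use norm_approx_le in auto)

lemma norm_exterior_part_approx_le:
  assumes "\<rho> / 2 < norm z"
  shows "norm (exterior_part (approx k) z) \<le>
    (real CARD('m))\<^sup>2 * \<rho> * \<kappa> * B * B' / (2 * (norm z - \<rho> / 2)) * (1/2) ^ k"
  using norm_exterior_part_le[OF approx_hol norm_approx_le assms, of k] by (simp add: mult_ac)

lemma summable_exterior_part:
  "\<rho> / 2 < norm z \<Longrightarrow> summable (\<lambda>k. exterior_part (approx k) z)"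
  by (rule summable_comparison_test'[OF sums_summable[OF sums_half_powers]])
     (rule norm_exterior_part_approx_le)

lemma interior_factor_hol: "matrix_holomorphic_on interior_factor (ball 0 (3 / 4 * \<rho>))"
  unfolding interior_factor_def
proof (rule matrix_holomorphic_on_suminf)
  fix x :: complex assume "x \<in> ball 0 (3 / 4 * \<rho>)"
  then obtain d where "d > 0" "cball x d \<subseteq> ball 0 (3 / 4 * \<rho>)"
    using open_ball open_contains_cball by blast
  then show "\<exists>d>0. \<exists>M. cball x d \<subseteq> ball 0 (3 / 4 * \<rho>) \<and> summable M \<and>
      (\<forall>k. \<forall>z\<in>cball x d. norm (approx k z) \<le> M k)"
    using sums_summable[OF sums_half_powers[of B]] norm_approx_le
    by (intro exI[of _ d] conjI exI[of _ "\<lambda>k. B * (1/2) ^ k"]) (blast | force)+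
qed (use \<rho>_pos in \<open>auto intro: matrix_holomorphic_on_subset[OF approx_hol]\<close>)

lemma exterior_factor_hol: "matrix_holomorphic_on exterior_factor {z. \<rho> / 2 < norm z}"
  unfolding exterior_factor_def
proof (intro matrix_holomorphic_on_add matrix_holomorphic_on_const matrix_holomorphic_on_suminf)
  fix x :: complex assume x: "x \<in> {z. \<rho> / 2 < norm z}"
  \<comment> \<open>Half the distance from \<open>x\<close> to the contour, so that all of
    \<open>cball x d\<close> stays at least \<open>d\<close> away from it.\<close>
  define d where "d = (norm x - \<rho> / 2) / 2"
  define C where "C = (real CARD('m))\<^sup>2 * \<rho> * \<kappa> * B * B'"
  have C: "C \<ge> 0"
    unfolding C_def using \<rho>_pos \<kappa>_nonneg B_nonneg B'_nonneg by simp
  have d: "d > 0" using x by (simp add: d_def)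
  have far: "d \<le> norm z - \<rho> / 2" if "z \<in> cball x d" for z
    using that norm_triangle_ineq2[of x z] by (simp add: d_def dist_norm field_simps)
  have "norm (exterior_part (approx k) z) \<le> C / (2 * d) * (1/2) ^ k" if z: "z \<in> cball x d" for k z
  proof -
    have "norm (exterior_part (approx k) z) \<le> C / (2 * (norm z - \<rho> / 2)) * (1/2) ^ k"
      unfolding C_def by (rule norm_exterior_part_approx_le) (use far[OF z] d in auto)
    also have "\<dots> \<le> C / (2 * d) * (1/2) ^ k"
      using far[OF z] d C by (intro mult_right_mono divide_left_mono) auto
    finally show ?thesis .
  qed
  moreover have "cball x d \<subseteq> {z. \<rho> / 2 < norm z}" using far d by force
  ultimately show "\<exists>d>0. \<exists>M. cball x d \<subseteq> {z. \<rho> / 2 < norm z} \<and> summable M \<and>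
      (\<forall>k. \<forall>z\<in>cball x d. norm (exterior_part (approx k) z) \<le> M k)"
    using d sums_summable[OF sums_half_powers[of "C / (2 * d)"]] by blast
qed (use open_norm_greater exterior_part_hol[OF approx_hol] in blast)+

text \<open>Summing \<open>step_eq_exterior\<close> over all iterates gives F - E = (G - 1) E - F
  K.\<close>

lemma factorization:
  assumes "\<rho> / 2 < norm z" "norm z < 3 / 4 * \<rho>"
  shows "interior_factor z ** (mat 1 + K z) = exterior_factor z ** E z"
proof -
  have s1: "summable (\<lambda>k. approx k z)" by (rule summable_approx) (use assms in simp)
  have s2: "summable (\<lambda>k. exterior_part (approx k) z)" by (rule summable_exterior_part[OF assms(1)])
  have z: "norm z < \<rho>" using assms \<rho>_pos by auto
  have "interior_factor z = E z + (\<Sum>k. approx (Suc k) z)"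
    unfolding interior_factor_def using suminf_split_head[OF s1] by (simp add: approx_0)
  also have "(\<Sum>k. approx (Suc k) z) = (\<Sum>k. exterior_part (approx k) z ** E z - approx k z ** K z)"
    by (simp add: approx_Suc step_eq_exterior[OF approx_hol assms(1) z])
  also have "\<dots> = (\<Sum>k. exterior_part (approx k) z ** E z) - (\<Sum>k. approx k z ** K z)"
    by (intro suminf_diff[symmetric] bounded_linear.summable[OF matrix_mult.bounded_linear_left] s1 s2)
  also have "(\<Sum>k. exterior_part (approx k) z ** E z) = (\<Sum>k. exterior_part (approx k) z) ** E z"
    by (rule bounded_linear.suminf[OF matrix_mult.bounded_linear_left s2, symmetric])
  also have "(\<Sum>k. approx k z ** K z) = interior_factor z ** K z"
    unfolding interior_factor_def
    by (rule bounded_linear.suminf[OF matrix_mult.bounded_linear_left s1, symmetric])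
  finally show ?thesis
    by (simp add: exterior_factor_def matrix_mult.add_left matrix_mult.add_right algebra_simps)
qed

text \<open>E contributes B, and the remaining terms, each multiplied by E, are dominated by a
  geometric series starting at B/2. Bounding the product instead of its factors keeps a single power
  of \<open>B\<close>.\<close>

lemma norm_exterior_factor_mult_le:
  assumes "5 / 8 * \<rho> \<le> norm z" "norm z \<le> \<rho>"
  shows "norm (exterior_factor z ** E z) \<le> 2 * B"
proof -
  have far: "\<rho> / 2 < norm z" using assms \<rho>_pos by auto
  note s = bounded_linear.summable[OF matrix_mult.bounded_linear_left summable_exterior_part[OF far]]
  have le: "norm (exterior_part (approx k) z ** E z) \<le> B / 2 * (1/2) ^ k" for k
    using norm_exterior_part_mult_le[OF approx_hol norm_approx_le assms, of k] by simp
  have "norm (\<Sum>k. exterior_part (approx k) z ** E z) \<le> (\<Sum>k. B / 2 * (1/2) ^ k)"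
    by (rule norm_suminf_le) (use le sums_summable[OF sums_half_powers] in auto)
  also have "\<dots> = B" using sums_unique[OF sums_half_powers[of "B / 2"]] by simp
  finally have "norm (\<Sum>k. exterior_part (approx k) z ** E z) \<le> B" .
  moreover have "exterior_factor z ** E z = E z + (\<Sum>k. exterior_part (approx k) z ** E z)"
    using bounded_linear.suminf[OF matrix_mult.bounded_linear_left summable_exterior_part[OF far], of "E z"]
    by (simp add: exterior_factor_def matrix_mult.add_left)
  ultimately show ?thesis
    using E_bound[OF assms(2)] norm_triangle_ineq[of "E z" "\<Sum>k. exterior_part (approx k) z ** E z"]
    by simp
qed

lemma norm_exterior_factor_minus_1_le:
  assumes "\<rho> / 2 < norm z"
  shows "norm (exterior_factor z - mat 1) \<le> (real CARD('m))\<^sup>2 * \<rho> * \<kappa> * B * B' / (norm z - \<rho> / 2)"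
proof -
  define C where "C = (real CARD('m))\<^sup>2 * \<rho> * \<kappa> * B * B'"
  define D where "D = norm z - \<rho> / 2"
  have "norm (\<Sum>k. exterior_part (approx k) z) \<le> (\<Sum>k. C / (2 * D) * (1/2) ^ k)"
    by (rule norm_suminf_le)
       (use norm_exterior_part_approx_le[OF assms] sums_summable[OF sums_half_powers] in
         \<open>auto simp: C_def D_def\<close>)
  also have "\<dots> = 2 * (C / (2 * D))" by (rule sums_unique[OF sums_half_powers, symmetric])
  also have "\<dots> = C / D" by simp
  finally show ?thesis by (simp add: exterior_factor_def C_def D_def)
qed

end

text \<open>The normalization at infinity that fixes the constant in Liouville's theorem.\<close>

lemma (in small_jump) exterior_factor_tendsto: "(exterior_factor \<longlongrightarrow> mat 1) at_infinity"
proof -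
  define C where "C = (real CARD('m))\<^sup>2 * \<rho> * \<kappa> * B * B'"
  have "((\<lambda>z. exterior_factor z - mat 1) \<longlongrightarrow> 0) at_infinity"
  proof (rule Lim_null_comparison)
    show "\<forall>\<^sub>F z in at_infinity. norm (exterior_factor z - mat 1) \<le> C / (norm z - \<rho> / 2)"
      unfolding eventually_at_infinity C_def
      by (intro exI[of _ "\<rho> / 2 + 1"]) (auto intro!: norm_exterior_factor_minus_1_le)
    have "filterlim (\<lambda>z :: complex. norm z - \<rho> / 2) at_top at_infinity"
      using filterlim_tendsto_add_at_top[OF tendsto_const[of "- \<rho> / 2"] filterlim_norm_at_top]
      by simp
    then show "((\<lambda>z :: complex. C / (norm z - \<rho> / 2)) \<longlongrightarrow> 0) at_infinity"
      by (intro tendsto_divide_0[OF tendsto_const] filterlim_at_top_imp_at_infinity)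
  qed
  then show ?thesis by (simp add: LIM_zero_iff)
qed

text \<open>The inverse jump differs from the identity by at most 2 \<kappa> times the norm of the
  identity; demanding \<open>small\<close> of the locale for this larger bound produces the constant
  32. \<open>Y\<close> is the inverse of \<open>G\<close>, and it is returned with a bound for its
  product with the inverse of E because only that product has size \<open>B\<close>.\<close>

lemma exact_factorization:
  fixes E K :: "complex \<Rightarrow> complex^'m^'m" and \<rho> r \<kappa> \<eta> B :: real
  assumes \<rho>: "0 < \<rho>" "\<rho> < r"
    and E_hol: "matrix_holomorphic_on E (ball 0 r)"
    and E_inv: "\<And>z. norm z < r \<Longrightarrow> invertible (E z)"
    and K_hol: "matrix_holomorphic_on K (ball 0 r - {0})"
    and K_bound: "\<And>z. \<rho> / 4 \<le> norm z \<Longrightarrow> norm z \<le> \<rho> \<Longrightarrow> norm (K z) \<le> \<kappa>"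
    and kernel: "\<And>w z. norm w \<le> \<rho> \<Longrightarrow> norm z \<le> \<rho> \<Longrightarrow>
                   norm (matrix_inv (E w) ** E z - mat 1) \<le> \<eta> / \<rho> * norm (w - z)"
    and E_bound: "\<And>z. norm z \<le> \<rho> \<Longrightarrow> norm (E z) \<le> B"
    and E'_bound: "\<And>z. norm z \<le> \<rho> \<Longrightarrow> norm (matrix_inv (E z)) \<le> B"
    and \<eta>: "\<eta> \<ge> 0" and \<kappa>: "\<kappa> \<le> 1 / 2"
    and small: "32 * (real CARD('m))\<^sup>2 * (\<kappa> * norm (mat 1 :: complex^'m^'m)) * (1 + \<eta>) \<le> 1"
  obtains E0 G Y where
    "nonsingular_analytic_on E0 (cball 0 \<rho>)"
    "nonsingular_analytic_on G {z. \<rho> \<le> norm z}"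
    "\<And>z. norm z = \<rho> \<Longrightarrow> E0 z ** (mat 1 + K z) = G z ** E z"
    "\<And>z. norm z = \<rho> \<Longrightarrow> norm (E0 z) \<le> 4 * norm (mat 1 :: complex^'m^'m) * B"
    "\<And>z. norm z = \<rho> \<Longrightarrow> Y z ** G z = mat 1"
    "\<And>z. norm z = \<rho> \<Longrightarrow> norm (matrix_inv (E z) ** Y z) \<le> 2 * B"
    "\<And>z. \<rho> / 2 < norm z \<Longrightarrow>
       norm (G z - mat 1) \<le> (real CARD('m))\<^sup>2 * \<rho> * \<kappa> * B * B / (norm z - \<rho> / 2)"
proof -
  define E' where "E' z = matrix_inv (E z)" for z
  define J where "J z = matrix_inv (mat 1 + K z)" for z
  define \<mu> where "\<mu> = norm (mat 1 :: complex^'m^'m)"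
  have \<mu>: "1 \<le> \<mu>" unfolding \<mu>_def by (rule norm_mat_1_ge_1)
  have "norm (K (of_real \<rho>)) \<le> \<kappa>" by (rule K_bound) (use \<rho> in auto)
  then have \<kappa>0: "0 \<le> \<kappa>" using norm_ge_zero order_trans by blast
  have E'_E: "E' z ** E z = mat 1" and E_E': "E z ** E' z = mat 1" if "norm z < r" for z
    using E_inv[OF that] by (simp_all add: E'_def matrix_inv_left matrix_inv_right)
  have E'_hol: "matrix_holomorphic_on E' (ball 0 r)"
    unfolding E'_def by (intro matrix_holomorphic_on_inverse E_hol E_inv) auto
  have IK_inv: "invertible (mat 1 + K z)" if "\<rho> / 4 \<le> norm z" "norm z \<le> \<rho>" for z
    by (rule invertible_near_identity) (use K_bound[OF that] \<kappa> in auto)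
  have J_right: "(mat 1 + K z) ** J z = mat 1" and J_left: "J z ** (mat 1 + K z) = mat 1"
    if "invertible (mat 1 + K z)" for z
    using that by (simp_all add: J_def matrix_inv_left matrix_inv_right)
  have IK_hol: "matrix_holomorphic_on (\<lambda>z. mat 1 + K z) (ball 0 r - {0})"
    by (intro matrix_holomorphic_intros K_hol)
  interpret P: small_jump E E' K \<rho> \<kappa> \<eta> B B
  proof
    show "16 * (real CARD('m))\<^sup>2 * \<kappa> * (1 + \<eta>) \<le> 1"
    proof -
      have "\<kappa> * 1 \<le> \<kappa> * (2 * \<mu>)" by (rule mult_left_mono) (use \<mu> \<kappa>0 in auto)
      then have "16 * (real CARD('m))\<^sup>2 * \<kappa> * (1 + \<eta>) \<le>
          16 * (real CARD('m))\<^sup>2 * (2 * (\<kappa> * \<mu>)) * (1 + \<eta>)"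
        using \<eta> by (intro mult_right_mono mult_left_mono) auto
      also have "\<dots> = 32 * (real CARD('m))\<^sup>2 * (\<kappa> * \<mu>) * (1 + \<eta>)" by simp
      also have "\<dots> \<le> 1" using small unfolding \<mu>_def .
      finally show ?thesis .
    qed
  qed (use \<rho> \<eta> kernel E_bound E'_bound K_bound E'_E in
      \<open>auto simp: E'_def[symmetric] intro: matrix_holomorphic_on_subset[OF E_hol]
        matrix_holomorphic_on_subset[OF E'_hol] matrix_holomorphic_on_subset[OF K_hol]\<close>)
  interpret D: small_jump "\<lambda>z. transpose (E' z)" "\<lambda>z. transpose (E z)"
    "\<lambda>z. transpose (J z - mat 1)" \<rho> "2 * \<kappa> * \<mu>" \<eta> B B
  proof
    show "16 * (real CARD('m))\<^sup>2 * (2 * \<kappa> * \<mu>) * (1 + \<eta>) \<le> 1"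
      using small by (simp add: \<mu>_def mult_ac)
    show "norm (transpose (J z - mat 1)) \<le> 2 * \<kappa> * \<mu>" if "\<rho> / 2 \<le> norm z" "norm z \<le> 3 / 4 * \<rho>" for z
      unfolding norm_transpose \<mu>_def
      by (rule norm_inverse_near_identity(1)[OF K_bound \<kappa> J_right[OF IK_inv]]) (use that \<rho> in auto)
    show "norm (transpose (E w) ** transpose (E' z) - mat 1) \<le> \<eta> / \<rho> * norm (w - z)"
      if "norm w < \<rho>" "norm z \<le> \<rho>" for w z
    proof -
      have "transpose (E w) ** transpose (E' z) - mat 1 = transpose (E' z ** E w - mat 1)"
        by (simp add: matrix_transpose_mul transpose_diff transpose_mat)
      then show ?thesis
        using kernel[of z w] that by (simp add: E'_def norm_minus_commute)
    qed
    show "transpose (E z) ** transpose (E' z) = mat 1" if "norm z < \<rho>" for z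
      using E'_E[of z] that \<rho> by (simp flip: matrix_transpose_mul add: transpose_mat)
    have "matrix_holomorphic_on J {z. \<rho> / 4 < norm z \<and> norm z < \<rho>}"
      unfolding J_def
      by (intro matrix_holomorphic_on_inverse matrix_holomorphic_on_subset[OF IK_hol])
         (use \<rho> IK_inv in auto)
    then show "matrix_holomorphic_on (\<lambda>z. transpose (J z - mat 1)) {z. \<rho> / 4 < norm z \<and> norm z < \<rho>}"
      by (intro matrix_holomorphic_intros)
  qed (use \<rho> \<eta> E_bound E'_bound in
      \<open>auto simp: E'_def[symmetric] intro!: matrix_holomorphic_on_transpose
        intro: matrix_holomorphic_on_subset[OF E_hol] matrix_holomorphic_on_subset[OF E'_hol]\<close>)
  define F where "F = P.interior_factor"
  define G where "G = P.exterior_factor"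
  define X where "X z = transpose (D.interior_factor z)" for z
  define Y where "Y z = transpose (D.exterior_factor z)" for z
  have FG: "F z ** (mat 1 + K z) = G z ** E z" if "\<rho> / 2 < norm z" "norm z < 3 / 4 * \<rho>" for z
    unfolding F_def G_def by (rule P.factorization[OF that])
  have XY: "J z ** X z = E' z ** Y z" if "\<rho> / 2 < norm z" "norm z < 3 / 4 * \<rho>" for z
  proof -
    have "transpose (D.interior_factor z ** transpose (J z)) =
        transpose (D.exterior_factor z ** transpose (E' z))"
      using D.factorization[OF that] by (simp add: transpose_diff transpose_mat)
    then show ?thesis by (simp add: matrix_transpose_mul X_def Y_def)
  qed
  have FXGY: "F z ** X z = G z ** Y z" if z: "\<rho> / 2 < norm z" "norm z < 3 / 4 * \<rho>" for z
  proof -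
    have inv: "invertible (mat 1 + K z)" by (rule IK_inv) (use z \<rho> in auto)
    have "F z ** X z = F z ** ((mat 1 + K z) ** J z) ** X z" by (simp add: J_right[OF inv])
    also have "\<dots> = F z ** (mat 1 + K z) ** (J z ** X z)" by (simp add: matrix_mul_assoc)
    also have "\<dots> = G z ** (E z ** E' z) ** Y z"
      unfolding FG[OF z] XY[OF z] by (simp add: matrix_mul_assoc)
    also have "\<dots> = G z ** Y z" using E_E'[of z] z \<rho> by simp
    finally show ?thesis .
  qed
  have F_hol: "matrix_holomorphic_on F (ball 0 (3 / 4 * \<rho>))"
    unfolding F_def by (rule P.interior_factor_hol)
  have G_hol: "matrix_holomorphic_on G {z. \<rho> / 2 < norm z}"
    unfolding G_def by (rule P.exterior_factor_hol)
  have FX_hol: "matrix_holomorphic_on (\<lambda>z. F z ** X z) (ball 0 (3 / 4 * \<rho>))"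
    unfolding X_def by (intro matrix_holomorphic_intros F_hol D.interior_factor_hol)
  have GY_hol: "matrix_holomorphic_on (\<lambda>z. G z ** Y z) {z. \<rho> / 2 < norm z}"
    unfolding Y_def by (intro matrix_holomorphic_intros G_hol D.exterior_factor_hol)
  have GY_lim: "((\<lambda>z. G z ** Y z) \<longlongrightarrow> mat 1) at_infinity"
    using matrix_mult.tendsto[OF P.exterior_factor_tendsto transpose_lim[OF D.exterior_factor_tendsto]]
    by (simp add: G_def Y_def transpose_mat)
  have lt: "\<rho> / 2 < 3 / 4 * \<rho>" using \<rho> by simp
  have liouville: "norm z < 3 / 4 * \<rho> \<Longrightarrow> F z ** X z = mat 1"
    "\<rho> / 2 < norm z \<Longrightarrow> G z ** Y z = mat 1" for z
    by (rule matrix_liouville_annulus[OF FX_hol GY_hol lt _ GY_lim]; use FXGY in blast)+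
  have F_inv: "invertible (F z)" if "norm z < 3 / 4 * \<rho>" for z
    by (rule invertible_if_mult_eq_1[OF liouville(1)[OF that]])
  have GY: "G z ** Y z = mat 1" if "\<rho> / 2 < norm z" for z
    by (rule liouville(2)[OF that])
  have G_inv: "invertible (G z)" if "\<rho> / 2 < norm z" for z
    by (rule invertible_if_mult_eq_1[OF GY[OF that]])

  \<comment> \<open>The series for F is controlled only up to 3\<rho>/4. On the annulus F equals G E
    J, and this expression continues it across the circle of radius \<rho>.\<close>
  define E0 where "E0 z = (if norm z < 5 / 8 * \<rho> then F z else G z ** E z ** J z)" for z
  have F_eq: "F z = G z ** E z ** J z" if z: "\<rho> / 2 < norm z" "norm z < 3 / 4 * \<rho>" for z
  proof -
    have "invertible (mat 1 + K z)" by (rule IK_inv) (use z \<rho> in auto)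
    from J_right[OF this] show ?thesis
      by (simp flip: FG[OF z] matrix_mul_assoc)
  qed
  have E0_F: "E0 z = F z" if "norm z < 3 / 4 * \<rho>" for z
    using F_eq that \<rho> by (auto simp: E0_def)
  have E0_G: "E0 z = G z ** E z ** J z" if "\<rho> / 2 < norm z" for z
    using F_eq that \<rho> by (auto simp: E0_def)
  \<comment> \<open>The bound on \<open>K\<close> ends at the circle; just outside it, invertibility
    of 1 + K persists because the determinant is continuous.\<close>
  define V where "V = {z. \<rho> / 2 < norm z \<and> norm z < r} \<inter> (\<lambda>z. det (mat 1 + K z)) -` (- {0})"
  have V_open: "open V"
    unfolding V_def
  proof (rule continuous_open_preimage)
    have "(\<lambda>z. det (mat 1 + K z)) holomorphic_on {z. \<rho> / 2 < norm z \<and> norm z < r}"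
      by (rule holomorphic_on_det[OF matrix_holomorphic_on_subset[OF IK_hol]]) (use \<rho> in auto)
    then show "continuous_on {z. \<rho> / 2 < norm z \<and> norm z < r} (\<lambda>z. det (mat 1 + K z))"
      by (rule holomorphic_on_imp_continuous_on)
    show "open {z :: complex. \<rho> / 2 < norm z \<and> norm z < r}" by (rule open_annulus)
  qed (simp add: open_Compl)
  have V_inv: "invertible (mat 1 + K z)" if "z \<in> V" for z
    using that by (auto simp: V_def invertible_det_nz)
  have "matrix_holomorphic_on E0 (ball 0 (3 / 4 * \<rho>))"
    using F_hol by (subst matrix_holomorphic_on_cong[where G = F]) (auto intro: E0_F)
  moreover have "matrix_holomorphic_on E0 V"
  proof (subst matrix_holomorphic_on_cong)
    show "matrix_holomorphic_on (\<lambda>z. G z ** E z ** J z) V"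
      unfolding J_def
      by (intro matrix_holomorphic_on_mult matrix_holomorphic_on_inverse V_inv
          matrix_holomorphic_on_subset[OF G_hol] matrix_holomorphic_on_subset[OF E_hol]
          matrix_holomorphic_on_subset[OF IK_hol]) (use \<rho> in \<open>auto simp: V_def\<close>)
  qed (auto simp: V_def E0_G)
  ultimately have E0_hol: "matrix_holomorphic_on E0 (ball 0 (3 / 4 * \<rho>) \<union> V)"
    by (intro matrix_holomorphic_on_Un open_ball V_open)
  have "cball 0 \<rho> \<subseteq> ball 0 (3 / 4 * \<rho>) \<union> V"
    using \<rho> IK_inv by (auto simp: V_def invertible_det_nz)
  then have E0_analytic: "matrix_analytic_on E0 (cball 0 \<rho>)"
    by (intro matrix_analytic_on_if_holomorphic[OF E0_hol] open_Un open_ball V_open)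
  have E0_inv: "invertible (E0 z)" if "norm z \<le> \<rho>" for z
  proof (cases "norm z < 3 / 4 * \<rho>")
    case True
    then show ?thesis by (simp add: E0_F F_inv)
  next
    case False
    have "invertible (mat 1 + K z)" by (rule IK_inv) (use that False \<rho> in auto)
    from J_left[OF this] have "invertible (J z)" by (rule invertible_if_mult_eq_1)
    moreover have "invertible (G z)" "invertible (E z)"
      using G_inv[of z] E_inv[of z] that False \<rho> by auto
    ultimately show ?thesis
      using False \<rho> by (subst E0_G) (auto intro!: invertible_mult)
  qed

  show ?thesis
  proof (rule that[of E0 G Y])
    show "nonsingular_analytic_on E0 (cball 0 \<rho>)"
      using E0_analytic E0_inv by (simp add: nonsingular_analytic_on_def)
    show "nonsingular_analytic_on G {z. \<rho> \<le> norm z}"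
      unfolding nonsingular_analytic_on_def
      by (intro conjI matrix_analytic_on_if_holomorphic[OF G_hol] open_norm_greater ballI G_inv)
         (use \<rho> in auto)
  next
    fix z :: complex assume z: "norm z = \<rho>"
    have inv: "invertible (mat 1 + K z)" by (rule IK_inv) (use z \<rho> in auto)
    have far: "\<rho> / 2 < norm z" using z \<rho> by simp
    show "E0 z ** (mat 1 + K z) = G z ** E z"
      by (simp add: E0_G[OF far] J_left[OF inv] flip: matrix_mul_assoc)
    have "norm (J z) \<le> 2 * \<mu>"
      unfolding \<mu>_def
      by (rule norm_inverse_near_identity(2)[OF K_bound \<kappa> J_right[OF inv]]) (use z \<rho> in auto)
    then have "norm (G z ** E z ** J z) \<le> (2 * B) * (2 * \<mu>)"
      unfolding G_def
      by (intro norm_matrix_mult_le_mono[OF P.norm_exterior_factor_mult_le]) (use z \<rho> in auto)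
    then show "norm (E0 z) \<le> 4 * norm (mat 1 :: complex^'m^'m) * B"
      by (simp add: E0_G[OF far] \<mu>_def mult_ac)
    show "Y z ** G z = mat 1"
      using GY[OF far] matrix_left_right_inverse by blast
    \<comment> \<open>In the transposed problem this is the exterior factor times its own E, hence
      the bound with one power of \<open>B\<close>.\<close>
    have "matrix_inv (E z) ** Y z = transpose (D.exterior_factor z ** transpose (E' z))"
      by (simp add: matrix_transpose_mul Y_def E'_def)
    then show "norm (matrix_inv (E z) ** Y z) \<le> 2 * B"
      using D.norm_exterior_factor_mult_le[of z] z \<rho> by simp
  next
    fix z :: complex assume "\<rho> / 2 < norm z"
    then show "norm (G z - mat 1) \<le> (real CARD('m))\<^sup>2 * \<rho> * \<kappa> * B * B / (norm z - \<rho> / 2)"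
      unfolding G_def by (rule P.norm_exterior_factor_minus_1_le)
  qed
qed

section \<open>Extending bounds from the circle to the disc\<close>

lemma maximum_modulus_disc:
  assumes f: "f holomorphic_on ball 0 r" and \<rho>: "\<rho> < r"
    and bound: "\<And>w. norm w = \<rho> \<Longrightarrow> norm (f w) \<le> M" and z: "norm z \<le> \<rho>"
  shows "norm (f z) \<le> M"
proof (rule maximum_modulus_frontier[of f "cball 0 \<rho>"])
  show "f holomorphic_on interior (cball 0 \<rho>)"
    by (rule holomorphic_on_subset[OF f]) (use \<rho> in auto)
  show "continuous_on (closure (cball 0 \<rho>)) f"
    using holomorphic_on_imp_continuous_on[OF f] by (rule continuous_on_subset) (use \<rho> in auto)
  have "frontier (cball (0 :: complex) \<rho>) \<subseteq> sphere 0 \<rho>"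
    by (simp add: frontier_cball)
  then show "\<And>z. z \<in> frontier (cball 0 \<rho>) \<Longrightarrow> norm (f z) \<le> M" using bound by auto
qed (use z in auto)

text \<open>Maximum modulus for f(z) / (z - x). The point x may lie on the circle, where the
  hypothesis at w = x carries no information about the quotient.\<close>

lemma difference_quotient_bound:
  assumes f: "f holomorphic_on ball 0 r" and \<rho>: "0 < \<rho>" "\<rho> < r"
    and x: "norm x \<le> \<rho>" "f x = 0"
    and bound: "\<And>w. norm w = \<rho> \<Longrightarrow> norm (f w) \<le> L * norm (w - x)" and z: "norm z \<le> \<rho>"
  shows "norm (f z) \<le> L * norm (z - x)"
proof -
  define q where "q = (\<lambda>w. if w = x then deriv f x else (f w - f x) / (w - x))"
  have q: "q holomorphic_on ball 0 r"
    unfolding q_def by (rule pole_lemma_open[OF f open_ball])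
  have le: "norm (q w) \<le> L" if "norm w = \<rho>" "w \<noteq> x" for w
    using bound[OF that(1)] that x by (simp add: q_def norm_divide field_simps)
  have "norm (q w) \<le> L" if w: "norm w = \<rho>" for w
  proof (cases "w = x")
    case True
    \<comment> \<open>Points of the circle tending to \<open>w\<close>; as 1/(k+1) < pi, none of
      them is \<open>w\<close> itself, and the bound passes to the limit.\<close>
    define u where "u k = w * cis (1 / real (Suc k))" for k
    have "(\<lambda>k. cis (1 / real (Suc k))) \<longlonglongrightarrow> cis 0"
      using LIMSEQ_Suc[OF lim_1_over_n[where 'a = real]] by (rule tendsto_cis)
    then have "u \<longlonglongrightarrow> w * cis 0" unfolding u_def by (intro tendsto_mult tendsto_const)
    moreover have "isCont q w"
      using q w \<rho> continuous_on_interior[OF holomorphic_on_imp_continuous_on[OF q], of w] by simp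
    ultimately have lim: "(\<lambda>k. q (u k)) \<longlonglongrightarrow> q w"
      using isCont_tendsto_compose[of w q u sequentially] by simp
    have "norm (q (u k)) \<le> L" for k
    proof (rule le)
      show "norm (u k) = \<rho>" by (simp add: u_def norm_mult w)
      have "1 / real (Suc k) \<le> 1" by simp
      then have "1 / real (Suc k) < pi" using pi_gt3 by linarith
      then have "sin (1 / real (Suc k)) > 0" by (intro sin_gt_zero) auto
      then have "cis (1 / real (Suc k)) \<noteq> 1" by (auto simp: complex_eq_iff)
      moreover have "w \<noteq> 0" using w \<rho> by auto
      ultimately show "u k \<noteq> x" by (simp add: u_def True[symmetric])
    qed
    with lim show ?thesis by (intro LIMSEQ_le_const2[OF tendsto_norm]) auto
  qed (use le w in auto)
  from maximum_modulus_disc[OF q \<rho>(2) this z] have "norm (q z) \<le> L" .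
  then show ?thesis
    using x by (cases "z = x") (auto simp: q_def norm_divide field_simps)
qed

lemma matrix_maximum_modulus_disc:
  fixes F :: "complex \<Rightarrow> complex^'m^'m"
  assumes F: "matrix_holomorphic_on F (ball 0 r)" and \<rho>: "\<rho> < r"
    and bound: "\<And>w. norm w = \<rho> \<Longrightarrow> norm (F w) \<le> M" and z: "norm z \<le> \<rho>"
  shows "norm (F z) \<le> (real CARD('m))\<^sup>2 * M"
  by (rule norm_matrix_le_entries, rule maximum_modulus_disc[OF matrix_holomorphic_on_entry[OF F] \<rho> _ z])
     (use bound norm_matrix_entry_le order_trans in blast)

lemma matrix_difference_quotient_bound:
  fixes F :: "complex \<Rightarrow> complex^'m^'m"
  assumes F: "matrix_holomorphic_on F (ball 0 r)" and \<rho>: "0 < \<rho>" "\<rho> < r"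
    and x: "norm x \<le> \<rho>" "F x = 0"
    and bound: "\<And>w. norm w = \<rho> \<Longrightarrow> norm (F w) \<le> L * norm (w - x)" and z: "norm z \<le> \<rho>"
  shows "norm (F z) \<le> (real CARD('m))\<^sup>2 * L * norm (z - x)"
proof -
  have "norm (F z) \<le> (real CARD('m))\<^sup>2 * (L * norm (z - x))"
  proof (rule norm_matrix_le_entries)
    fix i j
    have le: "norm (F w $ i $ j) \<le> L * norm (w - x)" if "norm w = \<rho>" for w
      using bound[OF that] norm_matrix_entry_le order_trans by blast
    show "norm (F z $ i $ j) \<le> L * norm (z - x)"
      by (rule difference_quotient_bound[OF matrix_holomorphic_on_entry[OF F] \<rho> x(1) _ le z])
         (simp_all add: x)
  qed
  then show ?thesis by (simp add: mult.assoc)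
qed

text \<open>One variable at a time is moved into the disc: first z with the other point on the
  circle, then w with z fixed inside. Each passage costs the square of \<open>CARD('m)\<close>,
  hence the fourth power.\<close>

lemma kernel_bound_disc:
  fixes E :: "complex \<Rightarrow> complex^'m^'m"
  assumes E: "matrix_holomorphic_on E (ball 0 r)" "\<And>z. norm z < r \<Longrightarrow> invertible (E z)"
    and \<rho>: "0 < \<rho>" "\<rho> < r"
    and bound: "\<And>w z. norm w = \<rho> \<Longrightarrow> norm z = \<rho> \<Longrightarrow>
                  norm (matrix_inv (E w) ** E z - mat 1) \<le> L * norm (w - z)"
    and w: "norm w \<le> \<rho>" and z: "norm z \<le> \<rho>"
  shows "norm (matrix_inv (E w) ** E z - mat 1) \<le> (real CARD('m)) ^ 4 * L * norm (w - z)"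
proof -
  have E': "matrix_holomorphic_on (\<lambda>w. matrix_inv (E w)) (ball 0 r)"
    by (rule matrix_holomorphic_on_inverse[OF E(1)]) (use E(2) in auto)
  have diag: "matrix_inv (E u) ** E u - mat 1 = 0" if "norm u \<le> \<rho>" for u
    using E(2)[of u] that \<rho> by (simp add: matrix_inv_left)
  have 1: "norm (matrix_inv (E u) ** E z - mat 1) \<le> (real CARD('m))\<^sup>2 * L * norm (z - u)"
    if u: "norm u = \<rho>" for u
  proof (rule matrix_difference_quotient_bound[where F = "\<lambda>z. matrix_inv (E u) ** E z - mat 1", OF _ \<rho> _ _ _ z])
    show "matrix_holomorphic_on (\<lambda>z. matrix_inv (E u) ** E z - mat 1) (ball 0 r)"
      by (intro matrix_holomorphic_intros E)
    show "norm (matrix_inv (E u) ** E w - mat 1) \<le> L * norm (w - u)" if "norm w = \<rho>" for w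
      using bound[OF u that] by (simp add: norm_minus_commute[of w u])
  qed (use u diag in auto)
  have "norm (matrix_inv (E w) ** E z - mat 1) \<le>
      (real CARD('m))\<^sup>2 * ((real CARD('m))\<^sup>2 * L) * norm (w - z)"
  proof (rule matrix_difference_quotient_bound[where F = "\<lambda>w. matrix_inv (E w) ** E z - mat 1", OF _ \<rho> z _ _ w])
    show "matrix_holomorphic_on (\<lambda>w. matrix_inv (E w) ** E z - mat 1) (ball 0 r)"
      by (intro matrix_holomorphic_intros E')
    show "norm (matrix_inv (E u) ** E z - mat 1) \<le> (real CARD('m))\<^sup>2 * L * norm (u - z)"
      if "norm u = \<rho>" for u
      using 1[OF that] by (simp add: norm_minus_commute[of z u])
  qed (use z diag in auto)
  then show ?thesis by (simp add: power2_eq_square power4_eq_xxxx mult_ac)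
qed

section \<open>Control of the pole at the origin\<close>

lemma meromorphic_pole_cancel:
  assumes hol: "f analytic_on cball 0 r - {0}" and mero: "f meromorphic_on cball 0 r" and r: "r > 0"
    and pole: "is_pole f 0 \<Longrightarrow> - zorder f 0 \<le> int p"
  obtains h where "h holomorphic_on ball 0 r" "\<And>z. norm z < r \<Longrightarrow> z \<noteq> 0 \<Longrightarrow> h z = z ^ p * f z"
proof -
  have f: "f holomorphic_on ball 0 r - {0}"
    by (rule analytic_imp_holomorphic[OF analytic_on_subset[OF hol]]) auto
  have "\<exists>l. ((\<lambda>z. z ^ p * f z) \<longlongrightarrow> l) (at 0)"
  proof (cases "is_pole f 0")
    case True
    define k where "k = nat (- zorder f 0)"
    define g where "g = zor_poly f 0"
    from zorder_exist_pole[OF f open_ball _ True] r obtain t where t: "t > 0"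
      "g holomorphic_on cball 0 t" "\<And>w. w \<in> cball 0 t - {0} \<Longrightarrow> f w = g w / w ^ k"
      unfolding g_def k_def by auto
    \<comment> \<open>Makes \<open>p - k\<close> below a genuine difference of natural
      numbers.\<close>
    have kp: "k \<le> p" using pole[OF True] by (simp add: k_def)
    have "isCont g 0"
      using continuous_on_interior[OF holomorphic_on_imp_continuous_on[OF t(2)], of 0] t(1) by simp
    then have "((\<lambda>w. w ^ (p - k) * g w) \<longlongrightarrow> 0 ^ (p - k) * g 0) (at 0)"
      by (intro tendsto_intros) (simp add: isCont_def)
    moreover have "\<forall>\<^sub>F w in at 0. w ^ (p - k) * g w = w ^ p * f w"
      unfolding eventually_at
    proof (intro exI[of _ t] conjI ballI impI t(1))
      fix w :: complex assume w: "w \<noteq> 0 \<and> dist w 0 < t"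
      then have "f w = g w / w ^ k" by (intro t(3)) auto
      then show "w ^ (p - k) * g w = w ^ p * f w"
        using w kp by (simp add: power_diff)
    qed
    ultimately have "((\<lambda>w. w ^ p * f w) \<longlongrightarrow> 0 ^ (p - k) * g 0) (at 0)"
      by (rule Lim_transform_eventually)
    then show ?thesis by blast
  next
    case False
    then obtain l where "(f \<longlongrightarrow> l) (at 0)"
      using meromorphic_on_not_essential[OF meromorphic_on_subset[OF mero, of "{0}"]] r
      by (auto simp: not_essential_def)
    then have "((\<lambda>z. z ^ p * f z) \<longlongrightarrow> 0 ^ p * l) (at 0)" by (intro tendsto_intros)
    then show ?thesis by blast
  qed
  then obtain l where l: "((\<lambda>z. z ^ p * f z) \<longlongrightarrow> l) (at 0)" by blast
  \<comment> \<open>The value of \<open>f\<close> at 0 is arbitrary, so \<open>h\<close> takes the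
    limit there.\<close>
  define h where "h z = (if z = 0 then l else z ^ p * f z)" for z
  have "h holomorphic_on ball 0 r"
  proof (rule no_isolated_singularity'[where K = "{0}"])
    have "(h \<longlongrightarrow> l) (at 0)"
      by (rule Lim_transform_eventually[OF l]) (auto simp: h_def eventually_at_filter)
    then show "(h \<longlongrightarrow> h z) (at z within ball 0 r)" if "z \<in> {0}" for z
      using that by (auto simp: h_def intro: tendsto_within_subset)
    have "(\<lambda>z. z ^ p * f z) holomorphic_on ball 0 r - {0}" by (intro holomorphic_intros f)
    then show "h holomorphic_on ball 0 r - {0}"
      by (rule holomorphic_transform) (auto simp: h_def)
  qed auto
  with that show thesis by (auto simp: h_def)
qed

text \<open>Maximum modulus is applied to z^p times each entry, which is analytic at 0. Dividing by
  z^p again costs at most 4^p, as the norm of z is at least \<rho>/4.\<close>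

lemma meromorphic_pole_bound:
  fixes C :: "complex \<Rightarrow> complex^'m^'m"
  assumes C: "meromorphic_pole_at_0_only C (cball 0 r) p" and \<rho>: "0 < \<rho>" "\<rho> < r"
    and bound: "\<And>w. norm w = \<rho> \<Longrightarrow> norm (C w) \<le> M" and z: "\<rho> / 4 \<le> norm z" "norm z \<le> \<rho>"
  shows "norm (C z) \<le> (real CARD('m))\<^sup>2 * (4 ^ p * M)"
proof (rule norm_matrix_le_entries)
  fix i j
  let ?f = "\<lambda>z. C z $ i $ j"
  have "?f analytic_on cball 0 r - {0}" "?f meromorphic_on cball 0 r"
    "is_pole ?f 0 \<Longrightarrow> - zorder ?f 0 \<le> int p"
    using C by (auto simp: meromorphic_pole_at_0_only_def matrix_analytic_on_def)
  moreover have "0 < r" using \<rho> by simp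
  ultimately obtain h where
    h: "h holomorphic_on ball 0 r" "\<And>z. norm z < r \<Longrightarrow> z \<noteq> 0 \<Longrightarrow> h z = z ^ p * ?f z"
    using meromorphic_pole_cancel[of ?f r p] by blast
  have "norm (h z) \<le> \<rho> ^ p * M"
  proof (rule maximum_modulus_disc[OF h(1) \<rho>(2) _ z(2)])
    fix w :: complex assume w: "norm w = \<rho>"
    then have "h w = w ^ p * ?f w" using \<rho> by (intro h) auto
    moreover have "norm (?f w) \<le> M" using bound[OF w] norm_matrix_entry_le order_trans by blast
    ultimately show "norm (h w) \<le> \<rho> ^ p * M"
      using \<rho> w by (simp add: norm_mult norm_power mult_left_mono)
  qed
  moreover have "h z = z ^ p * ?f z" using \<rho> z by (intro h) auto
  ultimately have *: "norm z ^ p * norm (?f z) \<le> \<rho> ^ p * M" by (simp add: norm_mult norm_power)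
  have "(\<rho> / 4) ^ p * norm (?f z) \<le> norm z ^ p * norm (?f z)"
    using \<rho> z by (intro mult_right_mono power_mono) auto
  also note *
  finally show "norm (?f z) \<le> 4 ^ p * M"
    using \<rho> by (simp add: power_divide field_simps)
qed

section \<open>The matching theorem\<close>

lemma norm_matrix_divide: "norm (matrix_divide A k) = norm A / norm k"
proof -
  have "matrix_divide A k $ i = (1 / k) *s A $ i" for i
    by (simp add: matrix_divide_def vector_scalar_mult_def)
  then have "norm (matrix_divide A k) = norm (1 / k) * norm A"
    unfolding norm_vec_def[of "matrix_divide A k"] norm_vec_def[of A]
    by (simp only: norm_vector_smult L2_set_right_distrib[OF norm_ge_zero])
  then show ?thesis by (simp add: norm_divide)
qed

text \<open>In \<kappa> the factor 4^p accounts for the pole of C and the remaining 4 for 1/z, both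
  at radius \<rho>/4. The \<eta> of the exact factorization is
  \<open>(real CARD('m)) ^ 4 * MQ * \<rho>\<close>, and its B is \<open>ME\<close> times the square
  of \<open>CARD('m)\<close>.\<close>

lemma matching_fixed_n:
  fixes P N C E :: "complex \<Rightarrow> complex^'m^'m" and \<rho> r \<beta> \<delta> MC ME MQ \<kappa> :: real
  assumes \<rho>: "0 < \<rho>" "\<rho> < r" and \<beta>: "\<beta> > 0" and MQ: "MQ \<ge> 0"
    and C: "meromorphic_pole_at_0_only C (cball 0 r) p"
    and E: "nonsingular_analytic_on E (cball 0 r)"
    and N: "\<And>z. norm z = \<rho> \<Longrightarrow> invertible (N z)"
    and matching: "\<And>z. norm z = \<rho> \<Longrightarrow>
      norm (P z ** matrix_inv (N z) ** E z - (mat 1 + matrix_divide (C z) (of_real \<beta> * z))) \<le> \<delta>"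
    and C_bound: "\<And>z. norm z = \<rho> \<Longrightarrow> norm (C z) \<le> MC"
    and E_bound: "\<And>z. norm z = \<rho> \<Longrightarrow> norm (E z) \<le> ME"
    and E'_bound: "\<And>z. norm z = \<rho> \<Longrightarrow> norm (matrix_inv (E z)) \<le> ME"
    and quotient: "\<And>z w. norm z = \<rho> \<Longrightarrow> norm w = \<rho> \<Longrightarrow>
      norm (matrix_inv (E z) ** E w - mat 1) \<le> MQ * norm (z - w)"
    and \<kappa>_def: "\<kappa> = 4 * (real CARD('m))\<^sup>2 * 4 ^ p * MC / (\<beta> * \<rho>)" and \<kappa>: "\<kappa> \<le> 1 / 2"
    and small: "32 * (real CARD('m))\<^sup>2 * (\<kappa> * norm (mat 1 :: complex^'m^'m))
                  * (1 + (real CARD('m)) ^ 4 * MQ * \<rho>) \<le> 1"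
  obtains E0 G \<Delta> where
    "nonsingular_analytic_on E0 (cball 0 \<rho>)"
    "nonsingular_analytic_on G {z. \<rho> \<le> norm z}"
    "\<And>z. norm z = \<rho> \<Longrightarrow> E0 z ** P z = (mat 1 + \<Delta> z) ** G z ** N z"
    "\<And>z. norm z = \<rho> \<Longrightarrow>
       norm (\<Delta> z) \<le> 8 * norm (mat 1 :: complex^'m^'m) * ((real CARD('m))\<^sup>2 * ME)\<^sup>2 * \<delta>"
    "\<And>z. norm z = r \<Longrightarrow>
       norm (G z - mat 1) \<le> 2 / r * (real CARD('m))\<^sup>2 * \<rho> * \<kappa> * ((real CARD('m))\<^sup>2 * ME)\<^sup>2"
proof -
  define K where "K z = matrix_divide (C z) (of_real \<beta> * z)" for z
  define B where "B = (real CARD('m))\<^sup>2 * ME"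
  define \<mu> where "\<mu> = norm (mat 1 :: complex^'m^'m)"
  have E_hol: "matrix_holomorphic_on E (ball 0 r)"
    unfolding matrix_holomorphic_on_def
  proof (intro allI analytic_imp_holomorphic)
    show "(\<lambda>z. E z $ i $ j) analytic_on ball 0 r" for i j
      using E analytic_on_subset[OF _ ball_subset_cball]
      by (auto simp: nonsingular_analytic_on_def matrix_analytic_on_def)
  qed
  have E_inv: "invertible (E z)" if "norm z < r" for z
    using E that by (simp add: nonsingular_analytic_on_def)
  have E'_hol: "matrix_holomorphic_on (\<lambda>z. matrix_inv (E z)) (ball 0 r)"
    by (intro matrix_holomorphic_on_inverse E_hol E_inv) auto
  have C_hol: "(\<lambda>z. C z $ i $ j) holomorphic_on ball 0 r - {0}" for i j
  proof (rule analytic_imp_holomorphic)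
    have "(\<lambda>z. C z $ i $ j) analytic_on cball 0 r - {0}"
      using C by (simp add: meromorphic_pole_at_0_only_def matrix_analytic_on_def)
    then show "(\<lambda>z. C z $ i $ j) analytic_on ball 0 r - {0}"
      by (rule analytic_on_subset) auto
  qed
  have K_hol: "matrix_holomorphic_on K (ball 0 r - {0})"
    unfolding matrix_holomorphic_on_def K_def matrix_divide_def vec_lambda_beta
    using \<beta> by (intro allI holomorphic_intros C_hol) auto
  have K_bound: "norm (K z) \<le> \<kappa>" if z: "\<rho> / 4 \<le> norm z" "norm z \<le> \<rho>" for z
  proof -
    have Cz: "norm (C z) \<le> (real CARD('m))\<^sup>2 * (4 ^ p * MC)"
      by (rule meromorphic_pole_bound[OF C \<rho> C_bound z])
    have "norm (K z) = norm (C z) / (\<beta> * norm z)"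
      using \<beta> by (simp add: K_def norm_matrix_divide norm_mult)
    also have "\<dots> \<le> (real CARD('m))\<^sup>2 * (4 ^ p * MC) / (\<beta> * (\<rho> / 4))"
    proof (rule frac_le[OF _ Cz])
      show "0 \<le> (real CARD('m))\<^sup>2 * (4 ^ p * MC)" using Cz norm_ge_zero order_trans by blast
      show "\<beta> * (\<rho> / 4) \<le> \<beta> * norm z" using z \<beta> by (intro mult_left_mono) auto
    qed (use \<rho> \<beta> in simp)
    also have "\<dots> = \<kappa>" by (simp add: \<kappa>_def)
    finally show ?thesis .
  qed
  have kernel: "norm (matrix_inv (E w) ** E z - mat 1) \<le> (real CARD('m)) ^ 4 * MQ * \<rho> / \<rho> * norm (w - z)"
    if "norm w \<le> \<rho>" "norm z \<le> \<rho>" for w z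
  proof -
    have "norm (matrix_inv (E w) ** E z - mat 1) \<le> (real CARD('m)) ^ 4 * MQ * norm (w - z)"
      by (rule kernel_bound_disc[OF E_hol E_inv \<rho> quotient that])
    then show ?thesis using \<rho> by (subst nonzero_mult_div_cancel_right) auto
  qed
  have EB: "norm (E z) \<le> B" if "norm z \<le> \<rho>" for z
    unfolding B_def by (rule matrix_maximum_modulus_disc[OF E_hol \<rho>(2) E_bound that])
  have E'B: "norm (matrix_inv (E z)) \<le> B" if "norm z \<le> \<rho>" for z
    unfolding B_def by (rule matrix_maximum_modulus_disc[OF E'_hol \<rho>(2) E'_bound that])
  have \<eta>: "0 \<le> (real CARD('m)) ^ 4 * MQ * \<rho>" using MQ \<rho> by simp
  from exact_factorization[OF \<rho> E_hol E_inv K_hol K_bound kernel EB E'B \<eta> \<kappa> small]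
  obtain E0 G Y where
    E0: "nonsingular_analytic_on E0 (cball 0 \<rho>)" and G: "nonsingular_analytic_on G {z. \<rho> \<le> norm z}"
    and eq: "\<And>z. norm z = \<rho> \<Longrightarrow> E0 z ** (mat 1 + K z) = G z ** E z"
    and E0_le: "\<And>z. norm z = \<rho> \<Longrightarrow> norm (E0 z) \<le> 4 * \<mu> * B"
    and YG: "\<And>z. norm z = \<rho> \<Longrightarrow> Y z ** G z = mat 1"
    and Y_le: "\<And>z. norm z = \<rho> \<Longrightarrow> norm (matrix_inv (E z) ** Y z) \<le> 2 * B"
    and G_le: "\<And>z. \<rho> / 2 < norm z \<Longrightarrow>
       norm (G z - mat 1) \<le> (real CARD('m))\<^sup>2 * \<rho> * \<kappa> * B * B / (norm z - \<rho> / 2)"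
    unfolding \<mu>_def by blast
  define R where "R z = P z ** matrix_inv (N z) ** E z - (mat 1 + K z)" for z
  \<comment> \<open>Inserting the exact factorization into the matching condition gives E0 P N^(-1)
    = G + E0 R E^(-1); factoring G out on the right, with Y as its inverse, leaves this error. Its
    two outer factors have size B each, up to constants.\<close>
  define \<Delta> where "\<Delta> z = E0 z ** R z ** (matrix_inv (E z) ** Y z)" for z
  show ?thesis
  proof (rule that[OF E0 G, of \<Delta>])
    fix z :: complex assume z: "norm z = \<rho>"
    have Ez: "E z ** matrix_inv (E z) = mat 1" using E_inv[of z] z \<rho> by (simp add: matrix_inv_right)
    have Nz: "matrix_inv (N z) ** N z = mat 1" using N[OF z] by (rule matrix_inv_left)
    have "E0 z ** (P z ** matrix_inv (N z) ** E z) = E0 z ** (mat 1 + K z) + E0 z ** R z"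
      by (simp add: R_def flip: matrix_mult.add_right)
    also have "\<dots> = G z ** E z + E0 z ** R z" by (simp add: eq[OF z])
    finally have "E0 z ** P z ** matrix_inv (N z) ** (E z ** matrix_inv (E z)) =
        G z ** (E z ** matrix_inv (E z)) + E0 z ** R z ** matrix_inv (E z)"
      by (metis matrix_mul_assoc matrix_mult.add_left)
    then have *: "E0 z ** P z ** matrix_inv (N z) = G z + E0 z ** R z ** matrix_inv (E z)"
      by (simp add: Ez)
    have "(mat 1 + \<Delta> z) ** G z = G z + E0 z ** R z ** matrix_inv (E z) ** (Y z ** G z)"
      by (simp add: \<Delta>_def matrix_mult.add_left matrix_mul_assoc)
    also have "\<dots> = E0 z ** P z ** matrix_inv (N z)" by (simp add: YG[OF z] *)
    finally show "E0 z ** P z = (mat 1 + \<Delta> z) ** G z ** N z"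
      by (simp add: Nz flip: matrix_mul_assoc)
    have "norm (R z) \<le> \<delta>" unfolding R_def K_def by (rule matching[OF z])
    then have "norm (\<Delta> z) \<le> 4 * \<mu> * B * \<delta> * (2 * B)"
      unfolding \<Delta>_def by (intro norm_matrix_mult_le_mono E0_le Y_le z)
    also have "\<dots> = 8 * \<mu> * B\<^sup>2 * \<delta>" by (simp add: power2_eq_square)
    finally show "norm (\<Delta> z) \<le> 8 * norm (mat 1 :: complex^'m^'m) * ((real CARD('m))\<^sup>2 * ME)\<^sup>2 * \<delta>"
      by (simp add: \<mu>_def B_def)
  next
    fix z :: complex assume z: "norm z = r"
    have "norm (K (of_real \<rho>)) \<le> \<kappa>" by (rule K_bound) (use \<rho> in auto)
    then have \<kappa>0: "0 \<le> \<kappa>" using norm_ge_zero order_trans by blast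
    have "norm (G z - mat 1) \<le> (real CARD('m))\<^sup>2 * \<rho> * \<kappa> * B * B / (norm z - \<rho> / 2)"
      by (rule G_le) (use z \<rho> in auto)
    \<comment> \<open>Since \<rho> < r, the denominator r - \<rho>/2 is at least r/2.\<close>
    also have "\<dots> \<le> (real CARD('m))\<^sup>2 * \<rho> * \<kappa> * B * B / (r / 2)"
    proof (rule divide_left_mono)
      have "0 \<le> (real CARD('m))\<^sup>2 * \<rho> * \<kappa> * (B * B)"
        by (rule mult_nonneg_nonneg[OF _ zero_le_square]) (use \<rho> \<kappa>0 in simp)
      then show "0 \<le> (real CARD('m))\<^sup>2 * \<rho> * \<kappa> * B * B" by (simp add: mult.assoc)
    qed (use z \<rho> in auto)
    also have "\<dots> = 2 / r * (real CARD('m))\<^sup>2 * \<rho> * \<kappa> * B\<^sup>2" by (simp add: power2_eq_square)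
    finally show "norm (G z - mat 1) \<le>
        2 / r * (real CARD('m))\<^sup>2 * \<rho> * \<kappa> * ((real CARD('m))\<^sup>2 * ME)\<^sup>2"
      by (simp add: B_def)
  qed
qed

section \<open>Letting n tend to infinity\<close>

lemma uniform_bigoE:
  assumes "uniform_bigo S X g"
  obtains M where "M \<ge> 0" "\<forall>\<^sub>F n in sequentially. \<forall>x\<in>S n. norm (X n x) \<le> M * norm (g n x)"
proof -
  from assms obtain M where M: "\<forall>\<^sub>F n in sequentially. \<forall>x\<in>S n. norm (X n x) \<le> M * norm (g n x)"
    unfolding uniform_bigo_def by blast
  have "\<forall>\<^sub>F n in sequentially. \<forall>x\<in>S n. norm (X n x) \<le> max M 0 * norm (g n x)"
    using M
  proof eventually_elim
    case (elim n)
    show ?case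
    proof
      fix x assume "x \<in> S n"
      with elim have "norm (X n x) \<le> M * norm (g n x)" by blast
      also have "\<dots> \<le> max M 0 * norm (g n x)" by (intro mult_right_mono) auto
      finally show "norm (X n x) \<le> max M 0 * norm (g n x)" .
    qed
  qed
  then show thesis by (intro that[of "max M 0"]) auto
qed

lemma tendsto_real_powr_neg:
  assumes "s < 0"
  shows "(\<lambda>n. real n powr s) \<longlonglongrightarrow> 0"
  by (rule tendsto_neg_powr[OF assms filterlim_real_sequentially])

theorem theorem1p2:
  fixes P N C E :: "nat \<Rightarrow> complex \<Rightarrow> complex^'m^'m"
    and a b c d e r :: real and p :: nat
  assumes "r > 0"
    and "a \<ge> 0" "b \<ge> 0" "c \<ge> 0" "d \<ge> 0" "e \<ge> 0"
    and "a \<le> e" "e < b" "d < min b c"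
    and "a = 0 \<longrightarrow> r > 1"
    and N_inv: "\<forall>\<^sub>F n in sequentially. \<forall>z\<in>shrinking_circle a n. invertible (N n z)"
    and matching: "uniform_bigo (shrinking_circle a)
        (\<lambda>n z. P n z ** matrix_inv (N n z) ** E n z
                 - (mat 1 + matrix_divide (C n z) (of_real (real n powr b) * z)))
        (\<lambda>n z. real n powr (- c))"
    and C_merom: "\<And>n. n \<ge> 1 \<Longrightarrow> meromorphic_pole_at_0_only (C n) (cball 0 r) p"
    and C_bounded: "uniform_bigo (shrinking_circle a) C (\<lambda>n z. 1 :: real)"
    and E_analytic: "\<And>n. n \<ge> 1 \<Longrightarrow> nonsingular_analytic_on (E n) (cball 0 r)"
    and E_bound: "uniform_bigo (shrinking_circle a) E (\<lambda>n z. real n powr (d / 2))"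
    and E_inv_bound: "uniform_bigo (shrinking_circle a)
        (\<lambda>n z. matrix_inv (E n z)) (\<lambda>n z. real n powr (d / 2))"
    and E_quotient: "uniform_bigo (\<lambda>n. shrinking_circle a n \<times> shrinking_circle a n)
        (\<lambda>n (z, w). matrix_inv (E n z) ** E n w - mat 1)
        (\<lambda>n (z, w). of_real (real n powr e) * (z - w))"
  shows "\<exists>E0 Einf :: nat \<Rightarrow> complex \<Rightarrow> complex^'m^'m.
      (\<forall>n\<ge>1. nonsingular_analytic_on (E0 n) (cball 0 (real n powr (- a)))) \<and>
      (\<forall>n\<ge>1. nonsingular_analytic_on (Einf n) {z. real n powr (- a) \<le> cmod z}) \<and>
      (\<exists>\<Delta> :: nat \<Rightarrow> complex \<Rightarrow> complex^'m^'m.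
         uniform_bigo (shrinking_circle a) \<Delta> (\<lambda>n z. real n powr (d - c)) \<and>
         (\<forall>\<^sub>F n in sequentially. \<forall>z\<in>shrinking_circle a n.
            E0 n z ** P n z = (mat 1 + \<Delta> n z) ** Einf n z ** N n z)) \<and>
      uniform_bigo (\<lambda>n. sphere 0 r) (\<lambda>n z. Einf n z - mat 1) (\<lambda>n z. real n powr (d - b))"
proof -
  define \<mu> where "\<mu> = norm (mat 1 :: complex^'m^'m)"
  define k where "k = real CARD('m)"
  obtain MR where MR: "MR \<ge> 0" "\<forall>\<^sub>F n in sequentially. \<forall>z\<in>shrinking_circle a n.
      norm (P n z ** matrix_inv (N n z) ** E n z
        - (mat 1 + matrix_divide (C n z) (of_real (real n powr b) * z))) \<le> MR * norm (real n powr (- c))"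
    using uniform_bigoE[OF matching] by blast
  obtain MC where MC: "MC \<ge> 0"
    "\<forall>\<^sub>F n in sequentially. \<forall>z\<in>shrinking_circle a n. norm (C n z) \<le> MC * norm (1 :: real)"
    using uniform_bigoE[OF C_bounded] by blast
  obtain M1 where M1: "M1 \<ge> 0"
    "\<forall>\<^sub>F n in sequentially. \<forall>z\<in>shrinking_circle a n. norm (E n z) \<le> M1 * norm (real n powr (d / 2))"
    using uniform_bigoE[OF E_bound] by blast
  obtain M2 where M2: "M2 \<ge> 0" "\<forall>\<^sub>F n in sequentially. \<forall>z\<in>shrinking_circle a n.
      norm (matrix_inv (E n z)) \<le> M2 * norm (real n powr (d / 2))"
    using uniform_bigoE[OF E_inv_bound] by blast
  obtain MQ where MQ: "MQ \<ge> 0" "\<forall>\<^sub>F n in sequentially. \<forall>x\<in>shrinking_circle a n \<times> shrinking_circle a n.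
      norm (case x of (z, w) \<Rightarrow> matrix_inv (E n z) ** E n w - mat 1) \<le>
      MQ * norm (case x of (z, w) \<Rightarrow> of_real (real n powr e) * (z - w))"
    using uniform_bigoE[OF E_quotient] by blast
  define ME where "ME = max M1 M2"
  define \<kappa> where "\<kappa> n = 4 * k\<^sup>2 * 4 ^ p * MC / (real n powr b * real n powr (- a))" for n
  \<comment> \<open>\<open>R\<Delta>\<close> and \<open>RG\<close> are the constants of
    \<open>matching_fixed_n\<close> with all powers of n taken out.\<close>
  define R\<Delta> where "R\<Delta> = 8 * \<mu> * (k\<^sup>2 * ME)\<^sup>2 * MR"
  define RG where "RG = 2 / r * k\<^sup>2 * (4 * k\<^sup>2 * 4 ^ p * MC) * (k\<^sup>2 * ME)\<^sup>2"
  define good where "good n E0 G \<Delta> \<longleftrightarrow>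
      (\<forall>z\<in>shrinking_circle a n. E0 z ** P n z = (mat 1 + \<Delta> z) ** G z ** N n z \<and>
         norm (\<Delta> z) \<le> R\<Delta> * real n powr (d - c)) \<and>
      (\<forall>z\<in>sphere 0 r. norm (G z - mat 1) \<le> RG * real n powr (d - b))"
    for n and E0 G \<Delta> :: "complex \<Rightarrow> complex^'m^'m"

  have \<kappa>_eq: "\<kappa> n = 4 * k\<^sup>2 * 4 ^ p * MC * real n powr (a - b)" for n
    by (simp add: \<kappa>_def powr_diff powr_minus field_simps)
  have "a < b" using assms by simp
  have ev_\<rho>: "\<forall>\<^sub>F n in sequentially. real n powr (- a) < r"
  proof (cases "a = 0")
    case True
    \<comment> \<open>The radius is 1 for n > 0, and r > 1 in this case; n = 0 is set aside because
      \<open>0 powr 0 = 0\<close>.\<close>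
    show ?thesis using eventually_gt_at_top[of 0]
      by eventually_elim (use True assms in simp)
  next
    case False
    then have "(\<lambda>n. real n powr (- a)) \<longlonglongrightarrow> 0" by (intro tendsto_real_powr_neg) (use assms in simp)
    then show ?thesis using \<open>r > 0\<close> by (rule order_tendstoD)
  qed
  have "\<kappa> \<longlonglongrightarrow> 4 * k\<^sup>2 * 4 ^ p * MC * 0"
    unfolding \<kappa>_eq by (intro tendsto_mult tendsto_const tendsto_real_powr_neg) (use \<open>a < b\<close> in simp)
  then have \<kappa>_lim: "\<kappa> \<longlonglongrightarrow> 0" by simp
  then have ev_\<kappa>: "\<forall>\<^sub>F n in sequentially. \<kappa> n < 1 / 2" by (rule order_tendstoD) simp
  \<comment> \<open>After expansion the two terms have orders n^(a-b) and n^(a-b) n^e n^(-a) =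
    n^(e-b); this is where e < b makes the iteration contract.\<close>
  have ev_small: "\<forall>\<^sub>F n in sequentially.
      32 * k\<^sup>2 * (\<kappa> n * \<mu>) * (1 + k ^ 4 * (MQ * real n powr e) * real n powr (- a)) < 1"
  proof -
    let ?c = "k ^ 4 * MQ * (4 * k\<^sup>2 * 4 ^ p * MC)"
    have "(\<lambda>n. 32 * k\<^sup>2 * \<mu> * (\<kappa> n + ?c * real n powr (e - b))) \<longlonglongrightarrow> 32 * k\<^sup>2 * \<mu> * (0 + ?c * 0)"
      by (intro tendsto_mult tendsto_add tendsto_const \<kappa>_lim tendsto_real_powr_neg) (use assms in simp)
    then have "\<forall>\<^sub>F n in sequentially. 32 * k\<^sup>2 * \<mu> * (\<kappa> n + ?c * real n powr (e - b)) < 1"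
      by (rule order_tendstoD) simp
    then show ?thesis
      using eventually_gt_at_top[of 0]
    proof eventually_elim
      case (elim n)
      have *: "real n powr (a - b) * (real n powr e * real n powr (- a)) = real n powr (e - b)"
        by (simp flip: powr_add)
      have "\<kappa> n * (k ^ 4 * (MQ * real n powr e) * real n powr (- a)) =
          ?c * (real n powr (a - b) * (real n powr e * real n powr (- a)))"
        unfolding \<kappa>_eq by (simp only: mult_ac)
      also note *
      finally have "\<kappa> n * (k ^ 4 * (MQ * real n powr e) * real n powr (- a)) = ?c * real n powr (e - b)" .
      moreover have "32 * k\<^sup>2 * (\<kappa> n * \<mu>) * (1 + x) = 32 * k\<^sup>2 * \<mu> * (\<kappa> n + \<kappa> n * x)" for x
        by (simp add: algebra_simps)
      ultimately have "32 * k\<^sup>2 * (\<kappa> n * \<mu>) * (1 + k ^ 4 * (MQ * real n powr e) * real n powr (- a)) =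
          32 * k\<^sup>2 * \<mu> * (\<kappa> n + ?c * real n powr (e - b))"
        by (simp only:)
      with elim show ?case by (simp only:)
    qed
  qed
  have ev_good: "\<forall>\<^sub>F n in sequentially. \<exists>E0 G \<Delta>.
      nonsingular_analytic_on E0 (cball 0 (real n powr (- a))) \<and>
      nonsingular_analytic_on G {z. real n powr (- a) \<le> cmod z} \<and> good n E0 G \<Delta>"
    using eventually_ge_at_top[of 1] ev_\<rho> ev_\<kappa> ev_small N_inv MR(2) MC(2) M1(2) M2(2) MQ(2)
  proof eventually_elim
    case (elim n)
    have n: "n \<ge> 1" "real n > 0" using elim by auto
    have circ: "z \<in> shrinking_circle a n \<longleftrightarrow> norm z = real n powr (- a)" for z
      by (simp add: shrinking_circle_def)
    show ?case
    proof (rule matching_fixed_n[of "real n powr (- a)" r "real n powr b" "MQ * real n powr e"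
        "C n" p "E n" "N n" "P n" "MR * real n powr (- c)" MC "ME * real n powr (d / 2)" "\<kappa> n"])
      show "meromorphic_pole_at_0_only (C n) (cball 0 r) p" "nonsingular_analytic_on (E n) (cball 0 r)"
        using C_merom E_analytic n by auto
    next
      fix z :: complex assume z: "norm z = real n powr (- a)"
      show "invertible (N n z)"
        "norm (P n z ** matrix_inv (N n z) ** E n z
          - (mat 1 + matrix_divide (C n z) (of_real (real n powr b) * z))) \<le> MR * real n powr (- c)"
        "norm (C n z) \<le> MC"
        using elim z by (auto simp: circ)
      have le: "M1 * real n powr (d / 2) \<le> ME * real n powr (d / 2)"
        "M2 * real n powr (d / 2) \<le> ME * real n powr (d / 2)"
        by (auto simp: ME_def intro!: mult_right_mono)
      have "norm (E n z) \<le> M1 * real n powr (d / 2)"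
        "norm (matrix_inv (E n z)) \<le> M2 * real n powr (d / 2)"
        using elim z by (auto simp: circ)
      with le show "norm (E n z) \<le> ME * real n powr (d / 2)"
        "norm (matrix_inv (E n z)) \<le> ME * real n powr (d / 2)" by linarith+
    next
      fix z w :: complex assume "norm z = real n powr (- a)" "norm w = real n powr (- a)"
      then have "(z, w) \<in> shrinking_circle a n \<times> shrinking_circle a n" by (simp add: circ)
      from bspec[OF elim(10) this] have "norm (matrix_inv (E n z) ** E n w - mat 1) \<le>
          MQ * norm (of_real (real n powr e) * (z - w))" by simp
      then show "norm (matrix_inv (E n z) ** E n w - mat 1) \<le> MQ * real n powr e * norm (z - w)"
        by (simp add: norm_mult mult.assoc)
    next
      fix E0 G \<Delta> :: "complex \<Rightarrow> complex^'m^'m"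
      assume E0: "nonsingular_analytic_on E0 (cball 0 (real n powr (- a)))"
        and G: "nonsingular_analytic_on G {z. real n powr (- a) \<le> cmod z}"
        and eq: "\<And>z. norm z = real n powr (- a) \<Longrightarrow>
          E0 z ** P n z = (mat 1 + \<Delta> z) ** G z ** N n z"
        and \<Delta>_le: "\<And>z. norm z = real n powr (- a) \<Longrightarrow>
          norm (\<Delta> z) \<le> 8 * norm (mat 1 :: complex^'m^'m) *
            ((real CARD('m))\<^sup>2 * (ME * real n powr (d / 2)))\<^sup>2 * (MR * real n powr (- c))"
        and G_le: "\<And>z. norm z = r \<Longrightarrow> norm (G z - mat 1) \<le> 2 / r * (real CARD('m))\<^sup>2 *
            real n powr (- a) * \<kappa> n * ((real CARD('m))\<^sup>2 * (ME * real n powr (d / 2)))\<^sup>2"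
      have sq: "(x * (y * real n powr (d / 2)))\<^sup>2 = (x * y)\<^sup>2 * real n powr d" for x y :: real
      proof -
        have "(real n powr (d / 2))\<^sup>2 = real n powr d"
          by (simp add: power2_eq_square flip: powr_add)
        then show ?thesis by (simp add: power_mult_distrib)
      qed
      have "8 * \<mu> * ((k\<^sup>2 * ME)\<^sup>2 * real n powr d) * (MR * real n powr (- c)) = R\<Delta> * real n powr (d - c)"
        by (simp add: R\<Delta>_def powr_diff powr_minus field_simps)
      then have \<Delta>_le': "norm (\<Delta> z) \<le> R\<Delta> * real n powr (d - c)" if "norm z = real n powr (- a)" for z
        using \<Delta>_le[OF that] unfolding sq by (simp add: \<mu>_def k_def)
      \<comment> \<open>The radius n^(-a) in the bound for G - 1 cancels the n^a contained in
        \<kappa>, so on the fixed circle of radius r the exponent d - b is reached.\<close>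
      have *: "real n powr (- a) * (real n powr (a - b) * real n powr d) = real n powr (d - b)"
        by (simp flip: powr_add)
      have "2 / r * k\<^sup>2 * real n powr (- a) * \<kappa> n * ((k\<^sup>2 * ME)\<^sup>2 * real n powr d) =
          RG * (real n powr (- a) * (real n powr (a - b) * real n powr d))"
        unfolding \<kappa>_eq RG_def by (simp only: mult_ac)
      also note *
      finally have "2 / r * k\<^sup>2 * real n powr (- a) * \<kappa> n * ((k\<^sup>2 * ME)\<^sup>2 * real n powr d) =
          RG * real n powr (d - b)" .
      then have "norm (G z - mat 1) \<le> RG * real n powr (d - b)" if "norm z = r" for z
        using G_le[OF that] unfolding sq by (simp add: k_def)
      with \<Delta>_le' eq have "good n E0 G \<Delta>"
        by (auto simp: good_def circ)
      with E0 G show ?thesis by blast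
    qed (use elim n MQ(1) in \<open>auto simp: \<kappa>_def k_def \<mu>_def\<close>)
  qed
  \<comment> \<open>Nonsingular analytic factors are required for every n, the estimates only for
    large n. Where no good triple exists, constant identity matrices serve; the implication lets one
    choice cover both cases.\<close>
  have "\<exists>E0 G \<Delta>.
      nonsingular_analytic_on E0 (cball 0 (real n powr (- a))) \<and>
      nonsingular_analytic_on G {z. real n powr (- a) \<le> cmod z} \<and>
      ((\<exists>E0 G \<Delta>. nonsingular_analytic_on E0 (cball 0 (real n powr (- a))) \<and>
        nonsingular_analytic_on G {z. real n powr (- a) \<le> cmod z} \<and> good n E0 G \<Delta>) \<longrightarrow>
       good n E0 G \<Delta>)" for n
  proof -
    have "nonsingular_analytic_on (\<lambda>z. mat 1 :: complex^'m^'m) S" for S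
      by (auto simp: nonsingular_analytic_on_def matrix_analytic_on_def
        intro: invertible_if_mult_eq_1[of _ "mat 1"])
    then show ?thesis by blast
  qed
  then obtain E0 G \<Delta> where
    E0: "\<And>n. nonsingular_analytic_on (E0 n) (cball 0 (real n powr (- a)))" and
    G: "\<And>n. nonsingular_analytic_on (G n) {z. real n powr (- a) \<le> cmod z}" and
    imp: "\<And>n. (\<exists>E0 G \<Delta>. nonsingular_analytic_on E0 (cball 0 (real n powr (- a))) \<and>
        nonsingular_analytic_on G {z. real n powr (- a) \<le> cmod z} \<and> good n E0 G \<Delta>) \<Longrightarrow>
       good n (E0 n) (G n) (\<Delta> n)"
    by metis
  from ev_good have good: "\<forall>\<^sub>F n in sequentially. good n (E0 n) (G n) (\<Delta> n)"
    by (rule eventually_mono) (rule imp)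
  show ?thesis
  proof (rule exI[of _ E0], rule exI[of _ G], intro conjI exI[of _ \<Delta>] allI impI E0 G)
    show "uniform_bigo (shrinking_circle a) \<Delta> (\<lambda>n z. real n powr (d - c))"
      unfolding uniform_bigo_def using good
      by (intro exI[of _ R\<Delta>]) (auto elim!: eventually_mono simp: good_def)
    show "\<forall>\<^sub>F n in sequentially. \<forall>z\<in>shrinking_circle a n.
        E0 n z ** P n z = (mat 1 + \<Delta> n z) ** G n z ** N n z"
      using good by eventually_elim (simp add: good_def)
    show "uniform_bigo (\<lambda>n. sphere 0 r) (\<lambda>n z. G n z - mat 1) (\<lambda>n z. real n powr (d - b))"
      unfolding uniform_bigo_def using good
      by (intro exI[of _ RG]) (auto elim!: eventually_mono simp: good_def)
  qed
qed

end
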